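(* Let $\Lambda$ be a discrete (locally finite) multiset in $\mathbb C$ partitioned, with multiplicity, into finite nonempty clusters $\Gamma_\alpha$. Let $c_\alpha\in\mathbb C$, let $0\le r_\alpha\le H<\infty$, and let $\Gamma'_\alpha$ be finite multisets such that for every $\alpha$ $$\Gamma_\alpha\cup\Gamma'_\alpha\subset\{z:|z-c_\alpha|\le r_\alpha\},\qquad m_\alpha:=|\Gamma_\alpha|=|\Gamma'_\alpha|,\qquad\sum_{\lambda\in\Gamma_\alpha}\lambda^p=\sum_{\mu\in\Gamma'_\alpha}\mu^p\quad(p=1,2),$$ and assume $\sup_{w\in\mathbb C}\sum_{|c_\alpha-w|<1}m_\alpha r_\alpha^3<\infty$. Set $\Lambda'=\sum_\alpha\Gamma'_\alpha$ and let $$Q(z)=\prod_\alpha\frac{\prod_{\mu\in\Gamma'_\alpha}(z-\mu)}{\prod_{\lambda\in\Gamma_\alpha}(z-\lambda)} .$$ Then multiplication by the meromorphic product $Q$, with poles canceled against the prescribed zeros, defines a bounded linear isomorphism $$M_Q:\mathcal I(\Lambda)\to\mathcal I(\Lambda'),\qquad f\mapsto Qf .$$ In particular, $\dim\mathcal I(\Lambda)=\dim\mathcal I(\Lambda')$. If these multisets are exact zero multisets, then $\iota(\Lambda)=\iota(\Lambda')$, including the value $+\infty$.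
   Context: $dA$ is planar Lebesgue measure. The Bargmann–Fock space $\mathcal F^2$ is the space of entire functions $f$ with $\|f\|_2^2=\frac1\pi\int_{\mathbb C}|f|^2e^{-|z|^2}dA<\infty$. Multisets have locally finite support and finite multiplicities and are identified with their counting measures; $|\Gamma|$ is the total multiplicity of a finite multiset, and sums and products over multisets are with multiplicity. $\mathcal I(\Lambda)$ is the subspace of $f\in\mathcal F^2$ vanishing on $\Lambda$ with at least the prescribed multiplicities. A multiset is an exact zero multiset if it equals the zero multiset (with multiplicities) of some nonzero $f\in\mathcal F^2$. For an exact zero multiset $\Lambda$, the exact insertion index is $$\iota(\Lambda)=\sup\{q\in\mathbb Z_{\ge0}:\Lambda+\nu\text{ is an exact zero multiset for every finite multiset }\nu\text{ with }|\nu|=q\}\in\mathbb Z_{\ge0}\cup\{+\infty\}.$$ Under the stated hypotheses the product $Q$ converges, independently of order, to a meromorphic function on $\mathbb C$: on each compact set, finitely many cluster factors are separated off and the logarithms of the remaining ones converge absolutely and uniformly; its zero-minus-pole divisor is $\Lambda'-\Lambda$. *)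

theory Defs
  imports
    "HOL-Complex_Analysis.Complex_Analysis"
    "HOL-Library.Function_Algebras"
    "HOL-Library.Multiset"
    "HOL-Library.Extended_Nat"
begin

text \<open>
  Possibly infinite multisets in the plane are represented by their counting functions
  \<open>complex \<Rightarrow> nat\<close>; finite multisets have the library type \<open>complex multiset\<close>.
\<close>

definition locally_finite :: "(complex \<Rightarrow> nat) \<Rightarrow> bool" where
  "locally_finite L \<longleftrightarrow> (\<forall>K. compact K \<longrightarrow> finite {z \<in> K. L z \<noteq> 0})"

definition partitioned_into ::
    "(complex \<Rightarrow> nat) \<Rightarrow> 'i set \<Rightarrow> ('i \<Rightarrow> complex multiset) \<Rightarrow> bool" where
  "partitioned_into L I \<Gamma> \<longleftrightarrow>
     (\<forall>\<alpha>\<in>I. \<Gamma> \<alpha> \<noteq> {#}) \<and>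
     (\<forall>z. finite {\<alpha> \<in> I. z \<in># \<Gamma> \<alpha>} \<and> L z = (\<Sum>\<alpha> | \<alpha> \<in> I \<and> z \<in># \<Gamma> \<alpha>. count (\<Gamma> \<alpha>) z))"

text \<open>
  The following is meaningful only if each point lies in finitely many of the multisets.
  If the diameters of \<open>\<Gamma> \<alpha> + \<Gamma>' \<alpha>\<close> are bounded and the nonempty \<open>\<Gamma> \<alpha>\<close> partition a locally finite
  multiset, this holds for the \<open>\<Gamma>' \<alpha>\<close>, and their sum is again locally finite.
\<close>

definition multiset_sum :: "'i set \<Rightarrow> ('i \<Rightarrow> complex multiset) \<Rightarrow> complex \<Rightarrow> nat" where
  "multiset_sum I \<Gamma> z = (\<Sum>\<alpha> | \<alpha> \<in> I \<and> z \<in># \<Gamma> \<alpha>. count (\<Gamma> \<alpha>) z)"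


definition fock :: "(complex \<Rightarrow> complex) set" where
  "fock = {f. f holomorphic_on UNIV \<and>
              integrable lborel (\<lambda>z. (cmod (f z))\<^sup>2 * exp (- (cmod z)\<^sup>2))}"

definition fock_norm :: "(complex \<Rightarrow> complex) \<Rightarrow> real" where
  "fock_norm f = sqrt (1 / pi * (LINT z|lborel. (cmod (f z))\<^sup>2 * exp (- (cmod z)\<^sup>2)))"

text \<open>Used only for entire functions that are not identically zero.\<close>

definition zero_multiset :: "(complex \<Rightarrow> complex) \<Rightarrow> complex \<Rightarrow> nat" where
  "zero_multiset f z = nat (zorder f z)"

definition vanishing_space :: "(complex \<Rightarrow> nat) \<Rightarrow> (complex \<Rightarrow> complex) set" where
  "vanishing_space L =
     {f \<in> fock. (\<forall>z. f z = 0) \<or> (\<forall>z. L z \<le> zero_multiset f z)}"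

definition exact_zero_multiset :: "(complex \<Rightarrow> nat) \<Rightarrow> bool" where
  "exact_zero_multiset L \<longleftrightarrow> (\<exists>f\<in>fock. (\<exists>z. f z \<noteq> 0) \<and> zero_multiset f = L)"

definition insertion_index :: "(complex \<Rightarrow> nat) \<Rightarrow> enat" where
  "insertion_index L =
     Sup (enat ` {q. \<forall>\<nu> :: complex multiset. size \<nu> = q \<longrightarrow>
                       exact_zero_multiset (\<lambda>z. L z + count \<nu> z)})"


definition cluster_factor :: "complex multiset \<Rightarrow> complex multiset \<Rightarrow> complex \<Rightarrow> complex" where
  "cluster_factor G G' z = (\<Prod>\<mu>\<in>#G'. z - \<mu>) / (\<Prod>\<xi>\<in>#G. z - \<xi>)"

text \<open>
  The product is the limit along the net of finite subsets of the index set, hence independent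
  of any order. At a point of some \<open>\<Gamma> \<alpha>\<close> the corresponding factor has a zero denominator, so the
  pointwise limit is meaningless there; \<^const>\<open>remove_sings\<close> replaces its value by the limit of the
  function at that point if it exists, and by \<open>0\<close> at a genuine pole.
\<close>

definition cluster_product ::
    "'i set \<Rightarrow> ('i \<Rightarrow> complex multiset) \<Rightarrow> ('i \<Rightarrow> complex multiset) \<Rightarrow> complex \<Rightarrow> complex" where
  "cluster_product I \<Gamma> \<Gamma>' =
     remove_sings (\<lambda>z. Lim (finite_subsets_at_top I)
                         (\<lambda>F. \<Prod>\<alpha>\<in>F. cluster_factor (\<Gamma> \<alpha>) (\<Gamma>' \<alpha>) z))"

text \<open>Here \<^const>\<open>remove_sings\<close> cancels the poles of \<open>Q\<close> against zeros of \<open>f\<close>.\<close>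

definition mult_operator :: "(complex \<Rightarrow> complex) \<Rightarrow> (complex \<Rightarrow> complex) \<Rightarrow> complex \<Rightarrow> complex" where
  "mult_operator Q f = remove_sings (\<lambda>z. Q z * f z)"


text \<open>For subspaces \<open>V\<close> and \<open>W\<close> of the Fock space; the last clause says that the inverse is bounded.\<close>

definition bounded_linear_iso ::
    "(complex \<Rightarrow> complex) set \<Rightarrow> (complex \<Rightarrow> complex) set \<Rightarrow>
     ((complex \<Rightarrow> complex) \<Rightarrow> complex \<Rightarrow> complex) \<Rightarrow> bool" where
  "bounded_linear_iso V W T \<longleftrightarrow>
     bij_betw T V W \<and>
     (\<forall>f\<in>V. \<forall>g\<in>V. T (\<lambda>z. f z + g z) = (\<lambda>z. T f z + T g z)) \<and>
     (\<forall>a. \<forall>f\<in>V. T (\<lambda>z. a * f z) = (\<lambda>z. a * T f z)) \<and>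
     (\<exists>C. \<forall>f\<in>V. fock_norm (T f) \<le> C * fock_norm f) \<and>
     (\<exists>C. \<forall>f\<in>V. fock_norm f \<le> C * fock_norm (T f))"

definition fun_scale :: "complex \<Rightarrow> (complex \<Rightarrow> complex) \<Rightarrow> complex \<Rightarrow> complex" where
  "fun_scale a f = (\<lambda>z. a * f z)"

definition hamel_basis :: "(complex \<Rightarrow> complex) set \<Rightarrow> (complex \<Rightarrow> complex) set \<Rightarrow> bool" where
  "hamel_basis B V \<longleftrightarrow>
     B \<subseteq> V \<and> \<not> module.dependent fun_scale B \<and> V \<subseteq> module.span fun_scale B"

text \<open>
  The dimension over the complex numbers as a cardinal, since the library's \<open>dim\<close> is \<open>0\<close> for
  infinite-dimensional spaces. Equality of dimensions is equality of cardinals, \<^const>\<open>ordIso\<close>.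
\<close>

definition cdim :: "(complex \<Rightarrow> complex) set \<Rightarrow> (complex \<Rightarrow> complex) rel" where
  "cdim V = card_of (SOME B. hamel_basis B V)"

lemma vector_space_fun_scale: "vector_space fun_scale"
  by unfold_locales (auto simp: fun_scale_def fun_eq_iff algebra_simps)

end

theory Submission
  imports Defs
begin

text \<open>
  The reason for the theorem is that the cluster pairs agree in size and in their first two power
  sums. In the logarithm of a cluster factor the constant, linear and quadratic terms of the expansion
  in \<open>1 / (z - c)\<close> therefore cancel, and for \<open>|z - c| \<ge> 2 r\<close> the logarithm has size
  \<open>O (m r^3 / |z - c|^3)\<close> (\<open>cluster_factor_eq_exp\<close>, \<open>norm_cluster_log_le\<close>). The masses
  \<open>m r^3\<close> are bounded on unit discs and the inverse cube is summable over the cells of a planar lattice,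
  so the logarithms of all clusters far from \<open>z\<close> have a sum that is bounded uniformly in \<open>z\<close>
  (\<open>decaying_sum_bounded\<close>, \<open>norm_prod_factor_bounded\<close>). On a fixed disc only finitely many clusters
  are near, and the product of the others converges uniformly to a zero-free holomorphic function;
  hence the convergence of the product to a meromorphic function and its divisor
  (\<open>uniform_limit_product\<close>, \<open>Qlim_local_form\<close>).

  The boundedness of \<open>f \<mapsto> Q f\<close> is not a pointwise matter, as \<open>Q\<close> has poles and there may be
  arbitrarily many small clusters near a point. It rests on the mean value property
  (\<open>density_T_le_circle_average\<close>). Given \<open>z\<close>, the product of \<open>f\<close> and the factors of the clusters near
  \<open>z\<close> is entire. On a circle around \<open>z\<close> of a fixed larger radius these factors are bounded, because the
  circle is far from their clusters; at \<open>z\<close> all remaining factors are bounded. Thus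
  \<open>|Q f|\<^sup>2 exp (-|z|\<^sup>2)\<close> at \<open>z\<close> is at most a constant times the average of \<open>|f|\<^sup>2 exp (-|w|\<^sup>2)\<close> over the circle, the Gaussian
  being absorbed by a zero-free entire function. Integrating over \<open>z\<close> gives the bound of
  the norms (\<open>T_bounded\<close>).

  The situation is symmetric in the two families of clusters, and the product for the exchanged
  families is \<open>1 / Q\<close>, so the inverse operator is bounded for the same reason. The isomorphism maps Hamel
  bases to Hamel bases and adds \<open>\<Lambda>' - \<Lambda>\<close> to the zero multiset, which yields the equality of dimensions
  and of insertion indices.
\<close>

section \<open>The cubic remainder of the logarithm\<close>

text \<open>
  The part of the logarithm that survives the two moment conditions: the linear and quadratic Taylor
  terms of \<open>Ln (1 - w)\<close> are removed.
\<close>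
definition log_remainder :: "complex \<Rightarrow> complex" where
  "log_remainder w = Ln (1 - w) + w + w\<^sup>2 / 2"

text \<open>
  The derivative of the remainder is \<open>- w\<^sup>2 / (1 - w)\<close>, of size at most \<open>2 |w|\<^sup>2\<close> when \<open>|w| \<le> 1/2\<close>;
  integrating along the segment from \<open>0\<close> gives the cubic bound.
\<close>
lemma norm_log_remainder_le:
  assumes "norm w \<le> 1/2"
  shows "norm (log_remainder w) \<le> 2 * norm w ^ 3"
proof -
  have "norm (log_remainder w - log_remainder 0) \<le> (2 * (norm w)\<^sup>2) * norm (w - 0)"
  proof (rule field_differentiable_bound[where S = "cball 0 (norm w)" and f' = "\<lambda>z. - (z\<^sup>2) / (1 - z)"])
    fix z :: complex assume z: "z \<in> cball 0 (norm w)"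
    then have nz: "norm z \<le> 1/2" "norm z \<le> norm w"
      using assms by auto
    have half: "norm (1 - z) \<ge> 1/2"
      using norm_triangle_ineq2[of 1 z] nz by simp
    have "Re z \<le> 1/2"
      using complex_Re_le_cmod[of z] nz by linarith
    then have ne: "1 - z \<notin> \<real>\<^sub>\<le>\<^sub>0"
      by (auto simp: complex_nonpos_Reals_iff)
    have ne1: "1 - z \<noteq> 0" using half by auto
    show "(log_remainder has_field_derivative - (z\<^sup>2) / (1 - z)) (at z within cball 0 (norm w))"
      unfolding log_remainder_def[abs_def] using ne ne1
      by (auto intro!: derivative_eq_intros simp: divide_simps power2_eq_square) (simp add: algebra_simps)
    have "norm (- (z\<^sup>2) / (1 - z)) = (norm z)\<^sup>2 / norm (1 - z)"
      by (simp add: norm_divide norm_power)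
    also have "\<dots> \<le> (norm w)\<^sup>2 / (1/2)"
      using nz half by (intro frac_le power_mono) auto
    finally show "norm (- (z\<^sup>2) / (1 - z)) \<le> 2 * (norm w)\<^sup>2" by simp
  qed auto
  then show ?thesis
    by (simp add: log_remainder_def power2_eq_square power3_eq_cube)
qed

lemma exp_log_remainder:
  assumes "w \<noteq> 1"
  shows "exp (log_remainder w) = (1 - w) * exp (w + w\<^sup>2 / 2)"
  using assms by (simp add: log_remainder_def exp_add add.assoc)

section \<open>Sums with cubic decay\<close>

text \<open>
  This is \<open>(1 + |a|) powr (-3/2)\<close>, half of the cubic decay. A lattice point has two coordinates, so the
  decay \<open>1 / (1 + |d|)^3\<close> is split evenly into a product of two one-variable weights, and each of these
  is still summable over the integers.
\<close>
definition lattice_weight :: "int \<Rightarrow> real" where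
  "lattice_weight a = 1 / ((1 + \<bar>a\<bar>) * sqrt (1 + \<bar>a\<bar>))"

lemma lattice_weight_nonneg: "lattice_weight a \<ge> 0"
  by (simp add: lattice_weight_def)

lemma sum_lattice_weight_bounded: "\<exists>W\<ge>0. \<forall>A. finite A \<longrightarrow> (\<Sum>a\<in>A. lattice_weight a) \<le> W"
proof -
  have sm: "summable (\<lambda>n::nat. lattice_weight (int n))"
  proof -
    have "summable (\<lambda>n. real (Suc n) powr (-3/2))"
      by (subst summable_Suc_iff) (simp add: summable_real_powr_iff)
    moreover have "real (Suc n) powr (-3/2) = lattice_weight (int n)" for n
    proof -
      have "real (Suc n) powr (-3/2) = real (Suc n) powr (-(1 + 1/2))" by simp
      also have "\<dots> = 1 / (real (Suc n) powr (1 + 1/2))"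
        by (simp only: powr_minus_divide)
      also have "\<dots> = lattice_weight (int n)"
        by (simp only: powr_add powr_half_sqrt lattice_weight_def) simp
      finally show ?thesis .
    qed
    ultimately show ?thesis by simp
  qed
  define W where "W = (\<Sum>n. lattice_weight (int n))"
  have W: "(\<Sum>n\<in>B. lattice_weight (int n)) \<le> W" if "finite B" for B :: "nat set"
    unfolding W_def using that by (intro sum_le_suminf sm) (auto simp: lattice_weight_nonneg)
  show ?thesis
  proof (intro exI[of _ "2 * W"] conjI allI impI)
    show "2 * W \<ge> 0" using W[of "{}"] by simp
  next
    fix A :: "int set" assume A: "finite A"
    have "(\<Sum>a\<in>A. lattice_weight a) = (\<Sum>a\<in>A \<inter> {0..}. lattice_weight a) + (\<Sum>a\<in>A - {0..}. lattice_weight a)"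
      using A by (metis sum.Int_Diff)
    also have "(\<Sum>a\<in>A \<inter> {0..}. lattice_weight a) = (\<Sum>n\<in>nat ` (A \<inter> {0..}). lattice_weight (int n))"
      by (subst sum.reindex) (auto simp: inj_on_def)
    also have "(\<Sum>a\<in>A - {0..}. lattice_weight a) = (\<Sum>n\<in>(\<lambda>a. nat (- a)) ` (A - {0..}). lattice_weight (int n))"
      by (subst sum.reindex) (auto simp: inj_on_def lattice_weight_def)
    also have "(\<Sum>n\<in>nat ` (A \<inter> {0..}). lattice_weight (int n)) + \<dots> \<le> W + W"
      using A by (intro add_mono W) auto
    finally show "(\<Sum>a\<in>A. lattice_weight a) \<le> 2 * W" by simp
  qed
qed

lemma decay_le_lattice_weight:
  fixes d :: complex
  shows "1 / (1 + cmod d) ^ 3 \<le> 8 * (lattice_weight \<lfloor>Re d\<rfloor> * lattice_weight \<lfloor>Im d\<rfloor>)"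
proof -
  define D where "D = 1 + cmod d"
  have D: "D \<ge> 1" by (simp add: D_def)
  have floor_le: "(1 + \<bar>\<lfloor>x\<rfloor>\<bar>) / 2 \<le> D" if "\<bar>x\<bar> \<le> cmod d" for x :: real
  proof -
    have "\<bar>real_of_int \<lfloor>x\<rfloor>\<bar> \<le> \<bar>x\<bar> + 1" by linarith
    then show ?thesis using that unfolding D_def by simp
  qed
  have w: "1 / (D * sqrt D) \<le> 2 * sqrt 2 * lattice_weight \<lfloor>x\<rfloor>" if "\<bar>x\<bar> \<le> cmod d" for x :: real
  proof -
    define y where "y = (1 + \<bar>real_of_int \<lfloor>x\<rfloor>\<bar>)"
    have y: "y > 0" "y / 2 \<le> D" using floor_le[OF that] by (auto simp: y_def)
    have "(y / 2) * sqrt (y / 2) \<le> D * sqrt D"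
      using y D by (intro mult_mono) auto
    then have "1 / (D * sqrt D) \<le> 1 / ((y / 2) * sqrt (y / 2))"
      using y D by (intro divide_left_mono mult_pos_pos) auto
    also have "\<dots> = 2 * sqrt 2 * lattice_weight \<lfloor>x\<rfloor>"
      using y unfolding lattice_weight_def y_def by (simp add: real_sqrt_divide)
    finally show ?thesis .
  qed
  have "1 / D ^ 3 = (1 / (D * sqrt D)) * (1 / (D * sqrt D))"
    using D by (simp add: power3_eq_cube field_simps)
  also have "\<dots> \<le> (2 * sqrt 2 * lattice_weight \<lfloor>Re d\<rfloor>) * (2 * sqrt 2 * lattice_weight \<lfloor>Im d\<rfloor>)"
    using D by (intro mult_mono w) (auto simp: abs_Re_le_cmod abs_Im_le_cmod lattice_weight_nonneg)
  also have "\<dots> = (sqrt 2 * sqrt 2) * (4 * (lattice_weight \<lfloor>Re d\<rfloor> * lattice_weight \<lfloor>Im d\<rfloor>))"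
    by (simp only: mult_ac)
  finally show ?thesis by (simp add: D_def)
qed

lemma near_centre_of_unit_cell:
  fixes d :: complex
  shows "cmod (d - Complex (\<lfloor>Re d\<rfloor> + 1/2) (\<lfloor>Im d\<rfloor> + 1/2)) < 1"
proof -
  have "\<bar>Re d - (\<lfloor>Re d\<rfloor> + 1/2)\<bar> \<le> 1/2" "\<bar>Im d - (\<lfloor>Im d\<rfloor> + 1/2)\<bar> \<le> 1/2"
    by linarith+
  then have "(Re d - (\<lfloor>Re d\<rfloor> + 1/2))\<^sup>2 \<le> (1/2)\<^sup>2" "(Im d - (\<lfloor>Im d\<rfloor> + 1/2))\<^sup>2 \<le> (1/2)\<^sup>2"
    by (intro abs_le_square_iff[THEN iffD1]; simp)+
  then have "(Re d - (\<lfloor>Re d\<rfloor> + 1/2))\<^sup>2 + (Im d - (\<lfloor>Im d\<rfloor> + 1/2))\<^sup>2 < 1"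
    by (simp add: power2_eq_square)
  then show ?thesis
    by (simp add: cmod_def)
qed

text \<open>
  A mass that is bounded on every unit disc has uniformly bounded cubic potential: the plane around
  \<open>z\<close> is cut into unit squares, each contained in an open unit disc, and the cubic weight is summable
  over the squares.
\<close>
lemma decaying_sum_bounded:
  fixes c :: "'i \<Rightarrow> complex" and u :: "'i \<Rightarrow> real"
  assumes nonneg: "\<And>\<alpha>. \<alpha> \<in> I \<Longrightarrow> u \<alpha> \<ge> 0"
    and loc: "\<And>w F. finite F \<Longrightarrow> F \<subseteq> {\<alpha>\<in>I. cmod (c \<alpha> - w) < 1} \<Longrightarrow> sum u F \<le> S"
  obtains C where "C \<ge> 0" "\<And>z F. finite F \<Longrightarrow> F \<subseteq> I \<Longrightarrow> (\<Sum>\<alpha>\<in>F. u \<alpha> / (1 + cmod (z - c \<alpha>)) ^ 3) \<le> C"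
proof -
  obtain W where W: "W \<ge> 0" "\<And>A. finite A \<Longrightarrow> (\<Sum>a\<in>A. lattice_weight a) \<le> W"
    using sum_lattice_weight_bounded by blast
  have S: "S \<ge> 0" using loc[of "{}"] by simp
  show ?thesis
  proof (rule that)
    show "8 * S * (W * W) \<ge> 0" using S W by simp
  next
    fix z F assume F: "finite F" "F \<subseteq> I"
    \<comment> \<open>Lower left corner of the unit square that contains the point, relative to \<open>z\<close>.\<close>
    define cell where "cell \<alpha> = (\<lfloor>Re (c \<alpha> - z)\<rfloor>, \<lfloor>Im (c \<alpha> - z)\<rfloor>)" for \<alpha>
    define v where "v k = 8 * (lattice_weight (fst k) * lattice_weight (snd k))" for k
    have v0: "v k \<ge> 0" for k by (simp add: v_def lattice_weight_nonneg)
    define A B where "A = fst ` cell ` F" and "B = snd ` cell ` F"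
    have fin: "finite A" "finite B" using F by (auto simp: A_def B_def)
    have cellAB: "cell ` F \<subseteq> A \<times> B" unfolding A_def B_def by (rule subset_fst_snd)
    have "(\<Sum>\<alpha>\<in>F. u \<alpha> / (1 + cmod (z - c \<alpha>)) ^ 3) \<le> (\<Sum>\<alpha>\<in>F. u \<alpha> * v (cell \<alpha>))"
    proof (rule sum_mono)
      fix \<alpha> assume "\<alpha> \<in> F"
      then have "u \<alpha> \<ge> 0" using nonneg F by auto
      then show "u \<alpha> / (1 + cmod (z - c \<alpha>)) ^ 3 \<le> u \<alpha> * v (cell \<alpha>)"
        using mult_left_mono[OF decay_le_lattice_weight[of "c \<alpha> - z"], of "u \<alpha>"]
        by (simp add: v_def cell_def norm_minus_commute)
    qed
    also have "\<dots> = (\<Sum>k\<in>A \<times> B. \<Sum>\<alpha> | \<alpha> \<in> F \<and> cell \<alpha> = k. u \<alpha> * v (cell \<alpha>))"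
      using F fin cellAB by (intro sum.group[symmetric]) auto
    also have "\<dots> \<le> (\<Sum>k\<in>A \<times> B. S * v k)"
    proof (rule sum_mono)
      fix k assume "k \<in> A \<times> B"
      have "(\<Sum>\<alpha> | \<alpha> \<in> F \<and> cell \<alpha> = k. u \<alpha> * v (cell \<alpha>)) = sum u {\<alpha>\<in>F. cell \<alpha> = k} * v k"
        by (simp add: sum_distrib_right)
      also have "sum u {\<alpha>\<in>F. cell \<alpha> = k} \<le> S"
      proof (rule loc[where w = "z + Complex (fst k + 1/2) (snd k + 1/2)"])
        show "{\<alpha>\<in>F. cell \<alpha> = k} \<subseteq> {\<alpha>\<in>I. cmod (c \<alpha> - (z + Complex (fst k + 1/2) (snd k + 1/2))) < 1}"
        proof safe
          fix \<alpha> assume "\<alpha> \<in> F" then show "\<alpha> \<in> I" using F by auto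
          show "cmod (c \<alpha> - (z + Complex (fst (cell \<alpha>) + 1/2) (snd (cell \<alpha>) + 1/2))) < 1"
            using near_centre_of_unit_cell[of "c \<alpha> - z"] by (simp add: cell_def algebra_simps)
        qed
      qed (use F in auto)
      finally show "(\<Sum>\<alpha> | \<alpha> \<in> F \<and> cell \<alpha> = k. u \<alpha> * v (cell \<alpha>)) \<le> S * v k"
        using v0[of k] by (simp add: mult_right_mono)
    qed
    also have "\<dots> = 8 * S * (\<Sum>k\<in>A \<times> B. lattice_weight (fst k) * lattice_weight (snd k))"
      unfolding sum_distrib_left by (rule sum.cong) (auto simp: v_def)
    also have "\<dots> = 8 * S * ((\<Sum>a\<in>A. lattice_weight a) * (\<Sum>b\<in>B. lattice_weight b))"
      by (simp add: sum_product sum.cartesian_product case_prod_unfold)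
    also have "\<dots> \<le> 8 * S * (W * W)"
    proof (rule mult_left_mono)
      show "(\<Sum>a\<in>A. lattice_weight a) * (\<Sum>b\<in>B. lattice_weight b) \<le> W * W"
        by (intro mult_mono W fin sum_nonneg lattice_weight_nonneg)
    qed (use S in simp)
    finally show "(\<Sum>\<alpha>\<in>F. u \<alpha> / (1 + cmod (z - c \<alpha>)) ^ 3) \<le> 8 * S * (W * W)" .
  qed
qed

section \<open>Mean values and zeros of entire functions\<close>

text \<open>
  The mean value property, in the form of an inequality between nonnegative integrals so that
  Tonelli's theorem applies to it directly.
\<close>
lemma norm_le_circle_integral:
  assumes h: "h holomorphic_on UNIV" and \<rho>: "\<rho> > 0"
  shows "ennreal (norm (h z)) \<le> (\<integral>\<^sup>+t\<in>{0..1}. ennreal (norm (h (circlepath z \<rho> t))) \<partial>lborel)"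
proof -
  define k where "k t = h (circlepath z \<rho> t)" for t
  have cont: "continuous_on {0..1} k"
    unfolding k_def
    by (intro continuous_on_compose2[OF holomorphic_on_imp_continuous_on[OF h]] path_circlepath[unfolded path_def]) auto
  have "((\<lambda>u. h u / (u - z)) has_contour_integral (2 * of_real pi * \<i> * h z)) (circlepath z \<rho>)"
    using \<rho> by (intro Cauchy_integral_circlepath holomorphic_on_imp_continuous_on)
      (auto intro: holomorphic_on_subset[OF h])
  then have "((\<lambda>t. h (circlepath z \<rho> t) / (circlepath z \<rho> t - z) * vector_derivative (circlepath z \<rho>) (at t))
      has_integral (2 * of_real pi * \<i> * h z)) {0..1}"
    unfolding has_contour_integral .
  also have "(\<lambda>t. h (circlepath z \<rho> t) / (circlepath z \<rho> t - z) * vector_derivative (circlepath z \<rho>) (at t))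
      = (\<lambda>t. (2 * of_real pi * \<i>) * k t)"
    using \<rho> by (simp add: vector_derivative_circlepath k_def fun_eq_iff) (simp add: circlepath)
  finally have "((\<lambda>t. (2 * of_real pi * \<i>) * k t) has_integral (2 * of_real pi * \<i>) * h z) {0..1}" .
  from has_integral_mult_right[OF this, of "1 / (2 * of_real pi * \<i>)"]
  have int: "(k has_integral h z) {0..1}" by simp
  have ni: "(\<lambda>t. norm (k t)) integrable_on {0..1}"
    by (intro integrable_continuous_real continuous_intros cont)
  have "norm (h z) \<le> integral {0..1} (\<lambda>t. norm (k t))"
    using integral_norm_bound_integral[OF has_integral_integrable[OF int] ni] int
    by (simp add: integral_unique)
  also have "ennreal (integral {0..1} (\<lambda>t. norm (k t))) = (\<integral>\<^sup>+t\<in>{0..1}. ennreal (norm (k t)) \<partial>lborel)"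
    using nn_integral_has_integral_lebesgue[OF _ integrable_integral[OF ni]]
    by (simp add: nn_integral_completion ennreal_mult ennreal_indicator mult.commute)
  finally show ?thesis by (simp add: k_def ennreal_leI)
qed

text \<open>
  Translation invariance of the area measure, after exchanging the two integrals: averaging over
  circles of a fixed radius does not change the total integral.
\<close>
lemma nn_integral_circle_averages:
  fixes u :: "complex \<Rightarrow> ennreal"
  assumes [measurable]: "u \<in> borel_measurable borel"
  shows "(\<integral>\<^sup>+z. (\<integral>\<^sup>+t\<in>{0..1}. u (circlepath z \<rho> t) \<partial>lborel) \<partial>lborel) = (\<integral>\<^sup>+z. u z \<partial>lborel)"
proof -
  have transl: "(\<integral>\<^sup>+z. u (a + z) \<partial>lborel) = (\<integral>\<^sup>+z. u z \<partial>lborel)" for a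
  proof -
    have "(\<integral>\<^sup>+z. u z \<partial>lborel) = (\<integral>\<^sup>+z. u z \<partial>distr lborel borel ((+) a))"
      by (simp add: lborel_distr_plus)
    also have "\<dots> = (\<integral>\<^sup>+z. u (a + z) \<partial>lborel)"
      by (rule nn_integral_distr) auto
    finally show ?thesis by simp
  qed
  have [measurable]: "(\<lambda>(z, t). circlepath z \<rho> t) \<in> borel_measurable (borel \<Otimes>\<^sub>M borel)"
    unfolding borel_prod circlepath case_prod_unfold
    by (intro borel_measurable_continuous_onI continuous_intros)
  have "(\<integral>\<^sup>+z. (\<integral>\<^sup>+t. u (circlepath z \<rho> t) * indicator {0..1} t \<partial>lborel) \<partial>lborel)
      = (\<integral>\<^sup>+t. (\<integral>\<^sup>+z. u (circlepath z \<rho> t) * indicator {0..1} t \<partial>lborel) \<partial>lborel)"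
    by (rule lborel_pair.Fubini') measurable
  also have "\<dots> = (\<integral>\<^sup>+t. (\<integral>\<^sup>+z. u z \<partial>lborel) * indicator {0..1::real} t \<partial>lborel)"
  proof (rule nn_integral_cong)
    fix t :: real
    have "(\<integral>\<^sup>+z. u (circlepath z \<rho> t) * indicator {0..1} t \<partial>lborel)
       = (\<integral>\<^sup>+z. u (\<rho> * exp (2 * of_real pi * \<i> * of_real t) + z) \<partial>lborel) * indicator {0..1} t"
      by (subst nn_integral_multc[symmetric]) (simp_all add: circlepath add.commute)
    then show "(\<integral>\<^sup>+z. u (circlepath z \<rho> t) * indicator {0..1} t \<partial>lborel)
       = (\<integral>\<^sup>+z. u z \<partial>lborel) * indicator {0..1} t" by (simp add: transl)
  qed
  also have "\<dots> = (\<integral>\<^sup>+z. u z \<partial>lborel)"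
    by (simp add: nn_integral_cmult_indicator)
  finally show ?thesis .
qed

text \<open>
  For an entire function that is not identically zero the order is a natural number, so the local
  factorization has an ordinary power and holds at the centre as well.
\<close>
lemma entire_local_factor:
  assumes "f holomorphic_on UNIV" "f w \<noteq> 0"
  shows "\<exists>e>0. \<exists>g. g holomorphic_on ball z e \<and> (\<forall>x\<in>ball z e. g x \<noteq> 0) \<and>
    (\<forall>x\<in>ball z e. f x = g x * (x - z) ^ nat (zorder f z)) \<and>
    zorder f z = int (nat (zorder f z)) \<and> (f z = 0 \<longleftrightarrow> zorder f z > 0)"
proof -
  have ex: "\<exists>w\<in>UNIV. f w \<noteq> 0" using assms(2) by blast
  from zorder_exist_zero[OF assms(1) open_UNIV connected_UNIV UNIV_I ex, of z]
  obtain r where r: "r > 0" "zor_poly f z holomorphic_on cball z r"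
    "\<And>x. x \<in> cball z r \<Longrightarrow> f x = zor_poly f z x * (x - z) ^ nat (zorder f z) \<and> zor_poly f z x \<noteq> 0"
    and s: "if f z = 0 then zorder f z > 0 else zorder f z = 0"
    by blast
  show ?thesis
    by (rule exI[of _ r], intro conjI exI[of _ "zor_poly f z"])
      (use r s in \<open>auto intro: holomorphic_on_subset split: if_splits\<close>)
qed

text \<open>
  One zero is divided out at a time; the difference quotient at a zero is again entire, and its order
  drops by one there and nowhere else.
\<close>
lemma entire_divide_finite_zeros:
  assumes "f holomorphic_on UNIV" "f w \<noteq> 0" "\<And>z. int (count M z) \<le> zorder f z"
  obtains g where "g holomorphic_on UNIV" "\<And>z. f z = (\<Prod>a\<in>#M. z - a) * g z"
  using assms
proof (induction M arbitrary: f thesis)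
  case empty
  then show ?case by auto
next
  case (add a M)
  note f = add.prems(2,3)
  have "zorder f a > 0" using add.prems(4)[of a] by simp
  then have fa: "f a = 0"
    using entire_local_factor[OF f, of a] by blast
  define g where "g z = (if z = a then deriv f a else (f z - f a) / (z - a))" for z
  have g: "g holomorphic_on UNIV"
    unfolding g_def using pole_lemma[OF f(1), of a] by simp
  have fg: "f z = (z - a) * g z" for z
    by (auto simp: g_def fa)
  have gw: "g w \<noteq> 0" using f(2) fg by auto
  have ord: "int (count M z) \<le> zorder g z" for z
  proof -
    obtain e h where he [rule_format]: "e > 0" "h holomorphic_on ball z e" "\<forall>x\<in>ball z e. h x \<noteq> 0"
        "\<forall>x\<in>ball z e. g x = h x * (x - z) ^ nat (zorder g z)"
        "zorder g z = int (nat (zorder g z))"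
      using entire_local_factor[OF g gw, of z] by (elim exE conjE) (rule that)
    have "zorder f z = zorder g z + (if z = a then 1 else 0)"
    proof (cases "z = a")
      case True
      have "zorder f z = int (Suc (nat (zorder g z)))"
        by (rule zorder_eqI[where S = "ball z e" and g = h])
          (use he(1-3) True in \<open>simp_all add: fg he(4) flip: of_nat_Suc\<close>)
      then show ?thesis using he True by simp
    next
      case False
      have "zorder f z = int (nat (zorder g z))"
        by (rule zorder_eqI[where S = "ball z e" and g = "\<lambda>x. (x - a) * h x"])
          (use he(1-3) False in \<open>auto intro!: holomorphic_intros simp: fg he(4) power_int_of_nat simp del: of_nat_nat int_nat_eq\<close>)
      then show ?thesis using he False by simp
    qed
    then show ?thesis using add.prems(4)[of z] by (auto split: if_splits)
  qed
  obtain k where k: "k holomorphic_on UNIV" "\<And>z. g z = (\<Prod>a\<in>#M. z - a) * k z"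
    using add.IH[OF _ g gw ord] by blast
  show ?case
    by (rule add.prems(1)[OF k(1)]) (simp add: fg k(2) mult_ac)
qed

lemma remove_sings_eq_holomorphic:
  assumes "open S" "F holomorphic_on S" "w \<in> S" "eventually (\<lambda>x. G x = F x) (at w)"
  shows "remove_sings G w = F w"
proof -
  have "F analytic_on {w}" using assms analytic_at by blast
  then show ?thesis
    using remove_sings_cong[OF assms(4) refl] by simp
qed

section \<open>Hamel dimension\<close>

text \<open>
  The image of a Hamel basis of \<open>V\<close> under \<open>T\<close> is independent and spans the same space as a Hamel basis
  of \<open>W\<close>, and two bases of one span have the same cardinality. A coordinate representation of a vector
  in \<open>V\<close> uses basis vectors in \<open>V\<close>, which is why linearity in the form of \<open>lin\<close> suffices.
\<close>
lemma cdim_ordIsoI: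
  assumes TV: "\<And>f. f \<in> V \<Longrightarrow> T f \<in> W" and TW: "\<And>g. g \<in> W \<Longrightarrow> T' g \<in> V"
    and inv: "\<And>f. f \<in> V \<Longrightarrow> T' (T f) = f" "\<And>g. g \<in> W \<Longrightarrow> T (T' g) = g"
    and zero: "0 \<in> W"
    and lin: "\<And>A a v. finite A \<Longrightarrow> A \<subseteq> V \<Longrightarrow> v \<in> V \<Longrightarrow> v = (\<Sum>b\<in>A. fun_scale (a b) b) \<Longrightarrow>
                T v = (\<Sum>b\<in>A. fun_scale (a b) (T b))"
    and lin': "\<And>A a v. finite A \<Longrightarrow> A \<subseteq> W \<Longrightarrow> v \<in> W \<Longrightarrow> v = (\<Sum>b\<in>A. fun_scale (a b) b) \<Longrightarrow>
                T' v = (\<Sum>b\<in>A. fun_scale (a b) (T' b))"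
  shows "(cdim V, cdim W) \<in> ordIso"
proof -
  interpret vs: vector_space fun_scale by (rule vector_space_fun_scale)
  have basis: "hamel_basis (SOME B. hamel_basis B U) U" for U
    by (rule someI_ex) (metis hamel_basis_def vs.maximal_independent_subset)
  define B C where "B = (SOME B. hamel_basis B V)" and "C = (SOME B. hamel_basis B W)"
  have B: "B \<subseteq> V" "vs.independent B" "V \<subseteq> vs.span B"
    and C: "C \<subseteq> W" "vs.independent C" "W \<subseteq> vs.span C"
    using basis[of V, folded B_def] basis[of W, folded C_def] unfolding hamel_basis_def by blast+
  have injT: "inj_on T V" by (metis inj_onI inv(1))
  have TB: "T ` B \<subseteq> W" using B TV by auto
  have T'T: "T' ` T ` B = B" using B inv(1) by (force simp: image_image)
  have "vs.independent (T ` B)"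
  proof (rule ccontr)
    assume "\<not> vs.independent (T ` B)"
    then obtain t a b where t: "finite t" "t \<subseteq> T ` B" "(\<Sum>g\<in>t. fun_scale (a g) g) = 0" "b \<in> t" "a b \<noteq> 0"
      unfolding vs.dependent_explicit by auto
    have tW: "g \<in> W" if "g \<in> t" for g using that t TB by blast
    have injt: "inj_on T' t" by (intro inj_on_inverseI[of _ T]) (simp add: inv tW)
    have "T' 0 = (\<Sum>g\<in>{}. fun_scale 0 (T' g))" using zero by (intro lin') auto
    then have "0 = T' 0" by simp
    also have "T' 0 = (\<Sum>g\<in>t. fun_scale (a g) (T' g))"
      using t tW zero by (intro lin') auto
    also have "\<dots> = (\<Sum>f\<in>T' ` t. fun_scale (a (T f)) f)"
      by (subst sum.reindex[OF injt]) (auto intro!: sum.cong simp: inv tW)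
    finally have "(\<Sum>f\<in>T' ` t. fun_scale (a (T f)) f) = 0" by simp
    moreover have "T' b \<in> T' ` t" "a (T (T' b)) \<noteq> 0" using t by (auto simp: inv tW)
    moreover have "finite (T' ` t)" "T' ` t \<subseteq> B" using t T'T by auto
    ultimately have "vs.dependent B" unfolding vs.dependent_explicit
      by (intro exI[of _ "T' ` t"] exI[of _ "\<lambda>f. a (T f)"]) blast
    then show False using B by simp
  qed
  moreover have "W \<subseteq> vs.span (T ` B)"
  proof
    fix g assume g: "g \<in> W"
    have "T' g \<in> vs.span B" using B TW g by auto
    then obtain t a where t: "finite t" "t \<subseteq> B" "T' g = (\<Sum>b\<in>t. fun_scale (a b) b)"
      unfolding vs.span_explicit by auto
    have "T (T' g) = (\<Sum>b\<in>t. fun_scale (a b) (T b))"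
      by (rule lin[OF t(1) _ TW[OF g] t(3)]) (use t B in auto)
    moreover have "(\<Sum>b\<in>t. fun_scale (a b) (T b)) \<in> vs.span (T ` B)"
      using t by (intro vs.span_sum vs.span_scale vs.span_base) auto
    ultimately show "g \<in> vs.span (T ` B)" using inv g by simp
  qed
  ultimately have "\<exists>f. bij_betw f (T ` B) C"
    using B C TB by (intro vs.bij_if_span_eq_span_bases) (auto simp: vs.span_eq)
  then obtain f where f: "bij_betw f (T ` B) C" by blast
  have "bij_betw T B (T ` B)" using injT B by (auto simp: bij_betw_def intro: inj_on_subset)
  from bij_betw_trans[OF this f] show ?thesis
    unfolding cdim_def B_def[symmetric] C_def[symmetric] by (rule card_of_ordIsoI)
qed

section \<open>A single cluster seen from afar\<close>

abbreviation root_poly :: "complex multiset \<Rightarrow> complex \<Rightarrow> complex" where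
  "root_poly M z \<equiv> (\<Prod>a\<in>#M. z - a)"

lemma root_poly_eq_0_iff: "root_poly M z = 0 \<longleftrightarrow> z \<in># M"
  by (induction M) auto

lemma holomorphic_on_root_poly [holomorphic_intros]: "root_poly M holomorphic_on A"
  by (induction M) (auto intro!: holomorphic_intros)

lemma root_poly_split:
  "root_poly M w = (w - z) ^ count M z * root_poly (filter_mset (\<lambda>a. a \<noteq> z) M) w"
  by (induction M) auto

lemma root_poly_sum: "root_poly (\<Sum>\<alpha>\<in>A. G \<alpha>) z = (\<Prod>\<alpha>\<in>A. root_poly (G \<alpha>) z)"
  by (induction A rule: infinite_finite_induct) auto

lemma norm_sum_mset_le:
  fixes f :: "'a \<Rightarrow> 'b::real_normed_vector" and B :: real
  assumes "\<And>x. x \<in># M \<Longrightarrow> norm (f x) \<le> B"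
  shows "norm (\<Sum>x\<in>#M. f x) \<le> size M * B"
  using assms
proof (induction M)
  case (add x M)
  then have "norm (f x) \<le> B" "norm (\<Sum>x\<in>#M. f x) \<le> size M * B" by auto
  then show ?case
    using norm_triangle_ineq[of "f x" "\<Sum>x\<in>#M. f x"] by (simp add: algebra_simps)
qed auto

text \<open>
  A logarithm of the cluster factor at points \<open>z\<close> away from the disc with centre \<open>c\<close> that contains both
  multisets. It is a sum of cubic remainders only, which is where the equality of the first two power
  sums enters.
\<close>
definition cluster_log :: "complex \<Rightarrow> complex multiset \<Rightarrow> complex multiset \<Rightarrow> complex \<Rightarrow> complex" where
  "cluster_log c G G' z = (\<Sum>\<mu>\<in>#G'. log_remainder ((\<mu> - c) / (z - c))) - (\<Sum>\<xi>\<in>#G. log_remainder ((\<xi> - c) / (z - c)))"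

lemma root_poly_eq_exp:
  assumes "z \<noteq> c" "z \<notin># M"
  shows "root_poly M z = (z - c) ^ size M * exp ((\<Sum>\<xi>\<in>#M. log_remainder ((\<xi> - c) / (z - c)))
           - (\<Sum>\<xi>\<in>#M. (\<xi> - c) / (z - c) + ((\<xi> - c) / (z - c))\<^sup>2 / 2))"
  using assms(2)
proof (induction M)
  case (add \<xi> M)
  define w where "w = (\<xi> - c) / (z - c)"
  have "w \<noteq> 1" using add.prems assms(1) by (auto simp: w_def field_simps)
  from exp_log_remainder[OF this] have "exp (log_remainder w - (w + w\<^sup>2 / 2)) = 1 - w"
    by (subst exp_diff) simp
  moreover have "z - \<xi> = (z - c) * (1 - w)" using assms(1) by (simp add: w_def field_simps)
  ultimately have "z - \<xi> = (z - c) * exp (log_remainder w - (w + w\<^sup>2 / 2))" by simp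
  then show ?case using add
    by (simp add: exp_add exp_diff flip: w_def)
qed auto

text \<open>
  The linear and quadratic terms of the logarithms depend on the cluster only through its size and its
  first two power sums, so they are the same for both members of a pair.
\<close>
lemma quadratic_part_by_power_sums:
  fixes M :: "complex multiset" and c d :: complex
  shows "(\<Sum>\<xi>\<in>#M. (\<xi> - c) / d + ((\<xi> - c) / d)\<^sup>2 / 2) =
    (\<Sum>\<^sub># M - size M * c) / d + ((\<Sum>\<xi>\<in>#M. \<xi>\<^sup>2) - 2 * c * \<Sum>\<^sub># M + size M * c\<^sup>2) / (2 * d\<^sup>2)"
  by (induction M) (simp_all add: add_divide_distrib diff_divide_distrib power2_eq_square algebra_simps)

lemma cluster_factor_eq_exp:
  assumes "z \<noteq> c" "z \<notin># G" "z \<notin># G'" "size G = size G'"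
    "\<Sum>\<^sub># G = \<Sum>\<^sub># G'" "(\<Sum>\<xi>\<in>#G. \<xi>\<^sup>2) = (\<Sum>\<xi>\<in>#G'. \<xi>\<^sup>2)"
  shows "cluster_factor G G' z = exp (cluster_log c G G' z)"
proof -
  define q where "q M = (\<Sum>\<xi>\<in>#M. (\<xi> - c) / (z - c) + ((\<xi> - c) / (z - c))\<^sup>2 / 2)" for M
  have "q G = q G'" unfolding q_def quadratic_part_by_power_sums assms(4-6) ..
  then show ?thesis
    using assms(1,4) root_poly_eq_exp[OF assms(1,2)] root_poly_eq_exp[OF assms(1,3)]
    by (simp add: cluster_factor_def cluster_log_def exp_diff flip: q_def)
qed

text \<open>
  Each of the \<open>2 m\<close> remainders has an argument of modulus at most \<open>r / |z - c| \<le> 1/2\<close>.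
\<close>
lemma norm_cluster_log_le:
  fixes r :: real
  assumes "\<And>\<xi>. \<xi> \<in># G \<Longrightarrow> cmod (\<xi> - c) \<le> r" "\<And>\<xi>. \<xi> \<in># G' \<Longrightarrow> cmod (\<xi> - c) \<le> r"
    and "size G = size G'" "0 \<le> r" "2 * r \<le> cmod (z - c)" "z \<noteq> c"
  shows "cmod (cluster_log c G G' z) \<le> 4 * size G * r ^ 3 / cmod (z - c) ^ 3"
proof -
  define d where "d = cmod (z - c)"
  have d: "d > 0" "2 * r \<le> d" using assms by (auto simp: d_def)
  have "cmod (log_remainder ((\<xi> - c) / (z - c))) \<le> 2 * (r / d) ^ 3" if "cmod (\<xi> - c) \<le> r" for \<xi>
  proof -
    have le: "cmod ((\<xi> - c) / (z - c)) \<le> r / d"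
      using that d unfolding norm_divide d_def[symmetric] by (simp add: divide_right_mono)
    also have "r / d \<le> 1/2" using d by simp
    finally have "cmod (log_remainder ((\<xi> - c) / (z - c))) \<le> 2 * cmod ((\<xi> - c) / (z - c)) ^ 3"
      by (rule norm_log_remainder_le)
    also have "\<dots> \<le> 2 * (r / d) ^ 3"
      using le by (intro mult_left_mono power_mono) auto
    finally show ?thesis .
  qed
  then have "cmod (\<Sum>\<xi>\<in>#M. log_remainder ((\<xi> - c) / (z - c))) \<le> size M * (2 * (r / d) ^ 3)"
    if "\<And>\<xi>. \<xi> \<in># M \<Longrightarrow> cmod (\<xi> - c) \<le> r" for M
    using that by (intro norm_sum_mset_le) auto
  from add_mono[OF this[of G'] this[of G]]
  have "cmod (cluster_log c G G' z) \<le> size G' * (2 * (r / d) ^ 3) + size G * (2 * (r / d) ^ 3)"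
    unfolding cluster_log_def using assms(1,2) by (intro norm_triangle_le_diff) auto
  also have "\<dots> = 4 * size G * r ^ 3 / d ^ 3"
    using assms(3) by (simp add: power_divide)
  finally show ?thesis by (simp add: d_def)
qed

lemma holomorphic_on_cluster_factor:
  assumes "\<And>z. z \<in> A \<Longrightarrow> z \<notin># G"
  shows "cluster_factor G G' holomorphic_on A"
  unfolding cluster_factor_def[abs_def]
  using assms by (intro holomorphic_intros) (auto simp: root_poly_eq_0_iff)

section \<open>Pairs of clusters and the limit of the product\<close>

text \<open>
  The hypotheses in a form that is symmetric in \<open>\<Gamma>\<close> and \<open>\<Gamma>'\<close>. Whatever is proved about multiplication
  by \<open>Q\<close> then holds for the multiplication in the opposite direction, which turns out to be the
  inverse. The bound \<open>S\<close> on the mass in unit discs is stated for finite partial sums, so no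
  summability has to be discussed.
\<close>
locale cluster_pair =
  fixes I :: "'i set" and \<Gamma> \<Gamma>' :: "'i \<Rightarrow> complex multiset"
    and c :: "'i \<Rightarrow> complex" and r :: "'i \<Rightarrow> real" and H S :: real
  assumes finite_centres: "finite {\<alpha>\<in>I. cmod (c \<alpha>) \<le> R}"
    and H_nonneg: "0 \<le> H"
    and radius: "\<alpha> \<in> I \<Longrightarrow> 0 \<le> r \<alpha>" "\<alpha> \<in> I \<Longrightarrow> r \<alpha> \<le> H"
    and in_disc: "\<alpha> \<in> I \<Longrightarrow> \<xi> \<in># \<Gamma> \<alpha> \<Longrightarrow> cmod (\<xi> - c \<alpha>) \<le> r \<alpha>"
    and in_disc': "\<alpha> \<in> I \<Longrightarrow> \<xi> \<in># \<Gamma>' \<alpha> \<Longrightarrow> cmod (\<xi> - c \<alpha>) \<le> r \<alpha>"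
    and size_eq: "\<alpha> \<in> I \<Longrightarrow> size (\<Gamma> \<alpha>) = size (\<Gamma>' \<alpha>)"
    and power_sum1: "\<alpha> \<in> I \<Longrightarrow> \<Sum>\<^sub># (\<Gamma> \<alpha>) = \<Sum>\<^sub># (\<Gamma>' \<alpha>)"
    and power_sum2: "\<alpha> \<in> I \<Longrightarrow> (\<Sum>\<xi>\<in>#\<Gamma> \<alpha>. \<xi>\<^sup>2) = (\<Sum>\<xi>\<in>#\<Gamma>' \<alpha>. \<xi>\<^sup>2)"
    and mass: "finite F \<Longrightarrow> F \<subseteq> {\<alpha>\<in>I. cmod (c \<alpha> - w) < 1} \<Longrightarrow> (\<Sum>\<alpha>\<in>F. size (\<Gamma> \<alpha>) * r \<alpha> ^ 3) \<le> S"
begin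

lemma swap: "cluster_pair I \<Gamma>' \<Gamma> c r H S"
  using size_eq mass
  by unfold_locales
    (auto simp: finite_centres H_nonneg radius in_disc in_disc' power_sum1 power_sum2 subset_iff intro: order_trans)

abbreviation "\<Lambda> \<equiv> multiset_sum I \<Gamma>"
abbreviation "\<Lambda>' \<equiv> multiset_sum I \<Gamma>'"

abbreviation "factor \<alpha> \<equiv> cluster_factor (\<Gamma> \<alpha>) (\<Gamma>' \<alpha>)"
abbreviation "logfactor \<alpha> \<equiv> cluster_log (c \<alpha>) (\<Gamma> \<alpha>) (\<Gamma>' \<alpha>)"

text \<open>
  The pointwise limit of the finite products. Its values matter only at points off \<open>\<Lambda>\<close>, where
  it agrees with \<open>Q\<close>.
\<close>
definition "Qlim z = Lim (finite_subsets_at_top I) (\<lambda>F. \<Prod>\<alpha>\<in>F. factor \<alpha> z)"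

abbreviation "Q \<equiv> cluster_product I \<Gamma> \<Gamma>'"

lemma Q_eq: "Q = remove_sings Qlim"
  unfolding cluster_product_def Qlim_def[abs_def] ..

text \<open>
  A cluster whose centre has distance at least \<open>sep\<close> from \<open>z\<close> is far from \<open>z\<close>: the distance is at least
  twice the radius of the cluster, so the estimates for a single cluster apply, and at least \<open>1\<close>, so
  that \<open>1 / |z - c|^3\<close> is comparable to the weight \<open>1 / (1 + |z - c|)^3\<close>.
\<close>
definition sep :: real where "sep = 2 * H + 1"

lemma sep: "sep \<ge> 1" "sep > H" "\<alpha> \<in> I \<Longrightarrow> 2 * r \<alpha> \<le> sep" "\<alpha> \<in> I \<Longrightarrow> r \<alpha> < sep"
  using H_nonneg radius[of \<alpha>] by (auto simp: sep_def)

lemma away_from_cluster: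
  assumes "\<alpha> \<in> I" "cmod (z - c \<alpha>) \<ge> sep"
  shows "z \<notin># \<Gamma> \<alpha>" "z \<notin># \<Gamma>' \<alpha>" "z \<noteq> c \<alpha>"
  using assms sep(4)[OF assms(1)] sep(1) in_disc[OF assms(1), of z] in_disc'[OF assms(1), of z] by auto

lemma factor_eq_exp:
  assumes "\<alpha> \<in> I" "cmod (z - c \<alpha>) \<ge> sep"
  shows "factor \<alpha> z = exp (logfactor \<alpha> z)"
  using away_from_cluster[OF assms] assms(1)
  by (intro cluster_factor_eq_exp) (auto simp: size_eq power_sum1 power_sum2)

abbreviation "mass3 \<alpha> \<equiv> size (\<Gamma> \<alpha>) * r \<alpha> ^ 3"

lemma mass3_nonneg: "\<alpha> \<in> I \<Longrightarrow> mass3 \<alpha> \<ge> 0"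
  by (simp add: radius)

lemma norm_logfactor_le:
  assumes "\<alpha> \<in> I" "cmod (z - c \<alpha>) \<ge> sep"
  shows "cmod (logfactor \<alpha> z) \<le> 32 * (mass3 \<alpha> / (1 + cmod (z - c \<alpha>)) ^ 3)"
proof -
  define d where "d = cmod (z - c \<alpha>)"
  have d: "d \<ge> 1" using assms sep(1) by (simp add: d_def)
  have "cmod (logfactor \<alpha> z) \<le> 4 * size (\<Gamma> \<alpha>) * r \<alpha> ^ 3 / d ^ 3"
    unfolding d_def using assms sep(3)[OF assms(1)] away_from_cluster[OF assms]
    by (intro norm_cluster_log_le) (auto simp: size_eq radius in_disc in_disc')
  also have "\<dots> = 4 * mass3 \<alpha> * (1 / d ^ 3)" by simp
  also have "1 / d ^ 3 \<le> 1 / ((1 + d) / 2) ^ 3"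
    using d by (intro divide_left_mono power_mono) auto
  also have "1 / ((1 + d) / 2) ^ 3 = 8 / (1 + d) ^ 3"
    by (simp add: power_divide)
  finally show ?thesis
    using mass3_nonneg[OF assms(1)] by (simp add: d_def mult_left_mono)
qed

lemma decaying_mass_bounded:
  obtains C where "C \<ge> 0"
    "\<And>z F. finite F \<Longrightarrow> F \<subseteq> I \<Longrightarrow> (\<Sum>\<alpha>\<in>F. mass3 \<alpha> / (1 + cmod (z - c \<alpha>)) ^ 3) \<le> C"
  using decaying_sum_bounded[of I mass3 c S] mass3_nonneg mass by blast

lemma sum_logfactor_bounded:
  obtains C where "C \<ge> 0"
    "\<And>z F. finite F \<Longrightarrow> F \<subseteq> I \<Longrightarrow> (\<And>\<alpha>. \<alpha> \<in> F \<Longrightarrow> cmod (z - c \<alpha>) \<ge> sep) \<Longrightarrow>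
       (\<Sum>\<alpha>\<in>F. cmod (logfactor \<alpha> z)) \<le> C"
proof -
  obtain C where C: "C \<ge> 0"
    "\<And>z F. finite F \<Longrightarrow> F \<subseteq> I \<Longrightarrow> (\<Sum>\<alpha>\<in>F. mass3 \<alpha> / (1 + cmod (z - c \<alpha>)) ^ 3) \<le> C"
    using decaying_mass_bounded by blast
  show ?thesis
  proof (rule that[of "32 * C"])
    fix z F assume F: "finite F" "F \<subseteq> I" "\<And>\<alpha>. \<alpha> \<in> F \<Longrightarrow> cmod (z - c \<alpha>) \<ge> sep"
    have "(\<Sum>\<alpha>\<in>F. cmod (logfactor \<alpha> z)) \<le> (\<Sum>\<alpha>\<in>F. 32 * (mass3 \<alpha> / (1 + cmod (z - c \<alpha>)) ^ 3))"
      using F by (intro sum_mono norm_logfactor_le) auto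
    also have "\<dots> \<le> 32 * C"
      unfolding sum_distrib_left[symmetric] using C(2)[OF F(1,2), of z] by simp
    finally show "(\<Sum>\<alpha>\<in>F. cmod (logfactor \<alpha> z)) \<le> 32 * C" .
  qed (use C in auto)
qed

text \<open>
  The far clusters multiply to a uniformly bounded factor, whatever finite set of them is taken and
  wherever the point lies.
\<close>
lemma norm_prod_factor_bounded:
  obtains B where "B > 0"
    "\<And>z F. finite F \<Longrightarrow> F \<subseteq> I \<Longrightarrow> (\<And>\<alpha>. \<alpha> \<in> F \<Longrightarrow> cmod (z - c \<alpha>) \<ge> sep) \<Longrightarrow>
       cmod (\<Prod>\<alpha>\<in>F. factor \<alpha> z) \<le> B"
proof -
  obtain C where C: "C \<ge> 0"
    "\<And>z F. finite F \<Longrightarrow> F \<subseteq> I \<Longrightarrow> (\<And>\<alpha>. \<alpha> \<in> F \<Longrightarrow> cmod (z - c \<alpha>) \<ge> sep) \<Longrightarrow>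
       (\<Sum>\<alpha>\<in>F. cmod (logfactor \<alpha> z)) \<le> C"
    using sum_logfactor_bounded by blast
  show ?thesis
  proof (rule that[of "exp C"])
    fix z F assume F: "finite F" "F \<subseteq> I" "\<And>\<alpha>. \<alpha> \<in> F \<Longrightarrow> cmod (z - c \<alpha>) \<ge> sep"
    have "(\<Prod>\<alpha>\<in>F. factor \<alpha> z) = (\<Prod>\<alpha>\<in>F. exp (logfactor \<alpha> z))"
      using F by (intro prod.cong factor_eq_exp) auto
    also have "\<dots> = exp (\<Sum>\<alpha>\<in>F. logfactor \<alpha> z)"
      using F by (simp add: exp_sum)
    also have "cmod \<dots> \<le> exp (cmod (\<Sum>\<alpha>\<in>F. logfactor \<alpha> z))"
      by (rule norm_exp)
    also have "\<dots> \<le> exp C"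
      using norm_sum[of "\<lambda>\<alpha>. logfactor \<alpha> z" F] C(2)[OF F] by simp
    finally show "cmod (\<Prod>\<alpha>\<in>F. factor \<alpha> z) \<le> exp C" .
  qed auto
qed

text \<open>
  On the disc \<open>cball 0 R\<close> the finitely many near clusters contribute a rational function with all the
  zeros and poles; the far ones contribute the exponential of a uniformly convergent sum.
\<close>
definition "near R = {\<alpha>\<in>I. cmod (c \<alpha>) \<le> R + sep}"
definition "far R = {\<alpha>\<in>I. cmod (c \<alpha>) > R + sep}"

lemma finite_near: "finite (near R)"
  unfolding near_def by (rule finite_centres)

lemma far_sep:
  assumes "\<alpha> \<in> far R" "z \<in> cball 0 R"
  shows "\<alpha> \<in> I" "cmod (z - c \<alpha>) \<ge> sep"
  using assms norm_triangle_ineq2[of "c \<alpha>" z] by (auto simp: far_def norm_minus_commute)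

definition "far_product R z = exp (\<Sum>\<^sub>\<infinity>\<alpha>\<in>far R. logfactor \<alpha> z)"

text \<open>
  For \<open>|z| \<le> R\<close> the weight \<open>1 / (1 + |z - c|)^3\<close> is at most \<open>(1 + R)^3\<close> times its value at \<open>z = 0\<close>, which
  gives a summable majorant not depending on \<open>z\<close>. The partial sums of the logarithms stay in a fixed
  disc, on which \<open>exp\<close> is uniformly continuous.
\<close>
lemma uniform_limit_far:
  assumes "R \<ge> 0"
  shows "uniform_limit (cball 0 R) (\<lambda>F z. \<Prod>\<alpha>\<in>F. factor \<alpha> z) (far_product R) (finite_subsets_at_top (far R))"
proof -
  obtain C where C: "C \<ge> 0"
    "\<And>z F. finite F \<Longrightarrow> F \<subseteq> I \<Longrightarrow> (\<Sum>\<alpha>\<in>F. mass3 \<alpha> / (1 + cmod (z - c \<alpha>)) ^ 3) \<le> C"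
    using decaying_mass_bounded by blast
  define K where "K = 32 * (1 + R) ^ 3"
  have K: "K \<ge> 0" using assms by (simp add: K_def)
  define M where "M \<alpha> = K * (mass3 \<alpha> / (1 + cmod (c \<alpha>)) ^ 3)" for \<alpha>
  have M: "cmod (logfactor \<alpha> z) \<le> M \<alpha>" if "\<alpha> \<in> far R" "z \<in> cball 0 R" for \<alpha> z
  proof -
    note fs = far_sep[OF that]
    have "cmod (c \<alpha>) \<le> cmod (z - c \<alpha>) + R"
      using norm_triangle_ineq2[of "c \<alpha>" z] that by (simp add: norm_minus_commute)
    moreover have "0 \<le> R * cmod (z - c \<alpha>)" using assms by simp
    ultimately have "1 + cmod (c \<alpha>) \<le> (1 + R) * (1 + cmod (z - c \<alpha>))"
      unfolding distrib_left distrib_right by linarith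
    then have "(1 + cmod (c \<alpha>)) ^ 3 \<le> (1 + R) ^ 3 * (1 + cmod (z - c \<alpha>)) ^ 3"
      unfolding power_mult_distrib[symmetric] by (intro power_mono) auto
    then have "1 / (1 + cmod (z - c \<alpha>)) ^ 3 \<le> (1 + R) ^ 3 / (1 + cmod (c \<alpha>)) ^ 3"
      using zero_less_power[of "1 + cmod (z - c \<alpha>)" 3] zero_less_power[of "1 + cmod (c \<alpha>)" 3]
      by (simp add: divide_simps add_pos_nonneg)
    then have "32 * (mass3 \<alpha> * (1 / (1 + cmod (z - c \<alpha>)) ^ 3)) \<le> 32 * (mass3 \<alpha> * ((1 + R) ^ 3 / (1 + cmod (c \<alpha>)) ^ 3))"
      using mass3_nonneg[OF fs(1)] by (intro mult_left_mono) auto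
    then show ?thesis
      using norm_logfactor_le[OF fs] by (simp add: M_def K_def mult_ac)
  qed
  have Mbound: "sum M F \<le> K * C" if "finite F" "F \<subseteq> far R" for F
    unfolding M_def sum_distrib_left[symmetric] using C(2)[OF that(1), of 0] that K
    by (intro mult_left_mono) (auto simp: far_def)
  have M0: "M \<alpha> \<ge> 0" if "\<alpha> \<in> far R" for \<alpha>
    using that K by (simp add: M_def far_def radius)
  have summable: "M summable_on far R"
    using Mbound by (intro nonneg_bdd_above_summable_on M0) (auto intro!: bdd_aboveI2)
  have lim: "uniform_limit (cball 0 R) (\<lambda>F z. \<Sum>\<alpha>\<in>F. logfactor \<alpha> z)
      (\<lambda>z. \<Sum>\<^sub>\<infinity>\<alpha>\<in>far R. logfactor \<alpha> z) (finite_subsets_at_top (far R))"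
    using M summable by (rule Weierstrass_m_test_general)
  have bd: "cmod (\<Sum>\<alpha>\<in>F. logfactor \<alpha> z) \<le> K * C" if "finite F" "F \<subseteq> far R" "z \<in> cball 0 R" for F z
  proof -
    have "cmod (\<Sum>\<alpha>\<in>F. logfactor \<alpha> z) \<le> sum M F"
      using that M by (intro sum_norm_le) auto
    then show ?thesis using Mbound that by fastforce
  qed
  have bdlim: "cmod (\<Sum>\<^sub>\<infinity>\<alpha>\<in>far R. logfactor \<alpha> z) \<le> K * C" if "z \<in> cball 0 R" for z
  proof (rule tendsto_upperbound)
    show "((\<lambda>F. cmod (\<Sum>\<alpha>\<in>F. logfactor \<alpha> z)) \<longlongrightarrow> cmod (\<Sum>\<^sub>\<infinity>\<alpha>\<in>far R. logfactor \<alpha> z)) (finite_subsets_at_top (far R))"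
      by (intro tendsto_norm tendsto_uniform_limitI[OF lim that])
    show "\<forall>\<^sub>F F in finite_subsets_at_top (far R). cmod (\<Sum>\<alpha>\<in>F. logfactor \<alpha> z) \<le> K * C"
      using bd that by (intro eventually_finite_subsets_at_top_weakI) auto
  qed auto
  have "uniform_limit (cball 0 R) (\<lambda>F z. exp (\<Sum>\<alpha>\<in>F. logfactor \<alpha> z))
      (exp \<circ> (\<lambda>z. \<Sum>\<^sub>\<infinity>\<alpha>\<in>far R. logfactor \<alpha> z)) (finite_subsets_at_top (far R))"
  proof (rule uniform_limit_compose[OF lim])
    show "uniformly_continuous_on (cball 0 (K * C)) (exp :: complex \<Rightarrow> complex)"
      by (intro compact_uniformly_continuous continuous_intros) auto
    show "\<forall>\<^sub>F F in finite_subsets_at_top (far R). (\<lambda>z. \<Sum>\<alpha>\<in>F. logfactor \<alpha> z) ` cball 0 R \<subseteq> cball 0 (K * C)"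
      using bd by (intro eventually_finite_subsets_at_top_weakI) auto
  qed (use bdlim in auto)
  moreover have "\<forall>\<^sub>F F in finite_subsets_at_top (far R). \<forall>z\<in>cball 0 R.
      exp (\<Sum>\<alpha>\<in>F. logfactor \<alpha> z) = (\<Prod>\<alpha>\<in>F. factor \<alpha> z)"
  proof (intro eventually_finite_subsets_at_top_weakI ballI)
    fix F and z :: complex assume "finite F" "F \<subseteq> far R" "z \<in> cball 0 R"
    then show "exp (\<Sum>\<alpha>\<in>F. logfactor \<alpha> z) = (\<Prod>\<alpha>\<in>F. factor \<alpha> z)"
      by (subst exp_sum) (auto intro!: prod.cong factor_eq_exp[symmetric] far_sep)
  qed
  ultimately show ?thesis
    by (subst (asm) uniform_limit_cong) (auto simp: far_product_def)
qed

lemma far_product_nonzero: "far_product R z \<noteq> 0"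
  by (simp add: far_product_def)

lemma far_product_holomorphic:
  assumes "R \<ge> 0"
  shows "continuous_on (cball 0 R) (far_product R)" "far_product R holomorphic_on ball 0 R"
proof -
  have "\<forall>\<^sub>F F in finite_subsets_at_top (far R).
      continuous_on (cball 0 R) (\<lambda>z. \<Prod>\<alpha>\<in>F. factor \<alpha> z) \<and> (\<lambda>z. \<Prod>\<alpha>\<in>F. factor \<alpha> z) holomorphic_on ball 0 R"
  proof (intro eventually_finite_subsets_at_top_weakI)
    fix F assume F: "finite F" "F \<subseteq> far R"
    have "(\<lambda>z. \<Prod>\<alpha>\<in>F. factor \<alpha> z) holomorphic_on cball 0 R"
    proof (intro holomorphic_on_prod holomorphic_on_cluster_factor)
      fix \<alpha> z assume "\<alpha> \<in> F" "z \<in> cball (0::complex) R"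
      then have "\<alpha> \<in> I" "cmod (z - c \<alpha>) \<ge> sep" using far_sep F by blast+
      then show "z \<notin># \<Gamma> \<alpha>" by (rule away_from_cluster)
    qed
    then show "continuous_on (cball 0 R) (\<lambda>z. \<Prod>\<alpha>\<in>F. factor \<alpha> z) \<and> (\<lambda>z. \<Prod>\<alpha>\<in>F. factor \<alpha> z) holomorphic_on ball 0 R"
      by (auto intro: holomorphic_on_imp_continuous_on holomorphic_on_subset)
  qed
  from holomorphic_uniform_limit[OF this uniform_limit_far[OF assms]]
  show "continuous_on (cball 0 R) (far_product R)" "far_product R holomorphic_on ball 0 R" by auto
qed

text \<open>
  A cluster that contains a point of \<open>cball 0 R\<close> has its centre within \<open>R + H\<close> of the origin, so the
  divisor on this disc comes from finitely many clusters.
\<close>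
lemma multiset_sum_eq_count_near:
  assumes "cmod z \<le> R"
  shows "\<Lambda> z = count (\<Sum>\<alpha>\<in>near R. \<Gamma> \<alpha>) z"
proof -
  have "{\<alpha>. \<alpha> \<in> I \<and> z \<in># \<Gamma> \<alpha>} \<subseteq> near R"
  proof safe
    fix \<alpha> assume \<alpha>: "\<alpha> \<in> I" "z \<in># \<Gamma> \<alpha>"
    then have "cmod (z - c \<alpha>) \<le> sep" using in_disc sep(4) by fastforce
    then show "\<alpha> \<in> near R"
      using \<alpha> assms norm_triangle_ineq2[of "c \<alpha>" z] by (auto simp: near_def norm_minus_commute)
  qed
  then have "\<Lambda> z = (\<Sum>\<alpha>\<in>near R. count (\<Gamma> \<alpha>) z)"
    unfolding multiset_sum_def
    by (intro sum.mono_neutral_left finite_near) (auto simp: near_def not_in_iff)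
  then show ?thesis by (simp add: count_sum)
qed

text \<open>
  A sum over an infinite index set would be \<open>0\<close> by convention; the finiteness of the set of near
  clusters excludes this.
\<close>
lemma multiset_sum_eq_0_iff: "\<Lambda> z = 0 \<longleftrightarrow> (\<forall>\<alpha>\<in>I. z \<notin># \<Gamma> \<alpha>)"
proof
  assume "\<Lambda> z = 0"
  show "\<forall>\<alpha>\<in>I. z \<notin># \<Gamma> \<alpha>"
  proof
    fix \<alpha> assume "\<alpha> \<in> I"
    define R where "R = cmod z + cmod (c \<alpha>)"
    have "\<alpha> \<in> near R" using \<open>\<alpha> \<in> I\<close> sep(1) by (simp add: near_def R_def)
    moreover have "(\<Sum>\<alpha>\<in>near R. count (\<Gamma> \<alpha>) z) = 0"
      using multiset_sum_eq_count_near[of z R] \<open>\<Lambda> z = 0\<close> by (simp add: R_def count_sum)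
    ultimately show "z \<notin># \<Gamma> \<alpha>" using finite_near by (auto simp: not_in_iff)
  qed
next
  assume "\<forall>\<alpha>\<in>I. z \<notin># \<Gamma> \<alpha>"
  then have "{\<alpha>. \<alpha> \<in> I \<and> z \<in># \<Gamma> \<alpha>} = {}" by blast
  then show "\<Lambda> z = 0" by (simp only: multiset_sum_def sum.empty)
qed

lemma uniform_limit_product:
  assumes R: "R \<ge> 0" and K: "compact K" "K \<subseteq> cball 0 R" "\<And>z. z \<in> K \<Longrightarrow> \<Lambda> z = 0"
  shows "uniform_limit K (\<lambda>F z. \<Prod>\<alpha>\<in>F. factor \<alpha> z)
     (\<lambda>z. (\<Prod>\<alpha>\<in>near R. factor \<alpha> z) * far_product R z) (finite_subsets_at_top I)"
proof -
  have "filterlim (\<lambda>F. F \<inter> far R) (finite_subsets_at_top (far R)) (finite_subsets_at_top I)"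
    unfolding filterlim_finite_subsets_at_top eventually_finite_subsets_at_top
    by (auto simp: far_def)
  from filterlim_compose[OF uniform_limit_on_subset[OF uniform_limit_far[OF R] K(2)] this]
  have far: "uniform_limit K (\<lambda>F z. \<Prod>\<alpha>\<in>F \<inter> far R. factor \<alpha> z) (far_product R) (finite_subsets_at_top I)" .
  have "(\<lambda>z. \<Prod>\<alpha>\<in>near R. factor \<alpha> z) holomorphic_on K"
    using K(3) by (intro holomorphic_on_prod holomorphic_on_cluster_factor)
      (auto simp: multiset_sum_eq_0_iff near_def)
  then have cont: "continuous_on K (\<lambda>z. \<Prod>\<alpha>\<in>near R. factor \<alpha> z)" "continuous_on K (far_product R)"
    using far_product_holomorphic(1)[OF R] K(2) by (auto intro: holomorphic_on_imp_continuous_on continuous_on_subset)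
  have "uniform_limit K (\<lambda>F z. (\<Prod>\<alpha>\<in>near R. factor \<alpha> z) * (\<Prod>\<alpha>\<in>F \<inter> far R. factor \<alpha> z))
      (\<lambda>z. (\<Prod>\<alpha>\<in>near R. factor \<alpha> z) * far_product R z) (finite_subsets_at_top I)"
    using cont K(1)
    by (intro uniform_lim_mult uniform_limit_const far compact_imp_bounded compact_continuous_image)
  moreover have "\<forall>\<^sub>F F in finite_subsets_at_top I. \<forall>z\<in>K.
      (\<Prod>\<alpha>\<in>near R. factor \<alpha> z) * (\<Prod>\<alpha>\<in>F \<inter> far R. factor \<alpha> z) = (\<Prod>\<alpha>\<in>F. factor \<alpha> z)"
    unfolding eventually_finite_subsets_at_top
  proof (intro exI[of _ "near R"] conjI finite_near allI impI ballI)
    fix F z assume F: "finite F \<and> near R \<subseteq> F \<and> F \<subseteq> I"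
    then have eq: "F = near R \<union> (F \<inter> far R)" and "near R \<inter> (F \<inter> far R) = {}"
      by (auto simp: near_def far_def)
    then show "(\<Prod>\<alpha>\<in>near R. factor \<alpha> z) * (\<Prod>\<alpha>\<in>F \<inter> far R. factor \<alpha> z) = (\<Prod>\<alpha>\<in>F. factor \<alpha> z)"
      using F finite_near by (subst eq, subst prod.union_disjoint) auto
  qed (auto simp: near_def)
  ultimately show ?thesis
    by (subst (asm) uniform_limit_cong) auto
qed

lemma tendsto_Qlim:
  assumes "\<Lambda> z = 0" "cmod z \<le> R"
  shows "((\<lambda>F. \<Prod>\<alpha>\<in>F. factor \<alpha> z) \<longlongrightarrow> Qlim z) (finite_subsets_at_top I)"
    and "Qlim z = (\<Prod>\<alpha>\<in>near R. factor \<alpha> z) * far_product R z"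
proof -
  have "R \<ge> 0" using assms(2) norm_ge_zero[of z] by linarith
  then have "((\<lambda>F. \<Prod>\<alpha>\<in>F. factor \<alpha> z) \<longlongrightarrow> (\<Prod>\<alpha>\<in>near R. factor \<alpha> z) * far_product R z) (finite_subsets_at_top I)"
    using assms by (intro tendsto_uniform_limitI[OF uniform_limit_product[of R "{z}"]]) auto
  moreover from this show "Qlim z = (\<Prod>\<alpha>\<in>near R. factor \<alpha> z) * far_product R z"
    unfolding Qlim_def by (intro tendsto_Lim) auto
  ultimately show "((\<lambda>F. \<Prod>\<alpha>\<in>F. factor \<alpha> z) \<longlongrightarrow> Qlim z) (finite_subsets_at_top I)"
    by simp
qed


section \<open>The meromorphic function and its divisor\<close>

text \<open>
  Near \<open>z\<close> the product of the near factors is a quotient of two polynomials, from which the powers of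
  \<open>w - z\<close> are split off; the remaining zeros have positive distance from \<open>z\<close>. The formula also
  holds at \<open>w = z\<close> itself if \<open>z\<close> is not a point of \<open>\<Lambda>\<close>, since then no factor has a vanishing
  denominator there.
\<close>
lemma Qlim_local_form:
  "\<exists>e>0. \<exists>g. g holomorphic_on ball z e \<and> (\<forall>w\<in>ball z e. g w \<noteq> 0) \<and>
    (\<forall>w\<in>ball z e. w \<noteq> z \<or> \<Lambda> z = 0 \<longrightarrow> \<Lambda> w = 0) \<and>
    (\<forall>w\<in>ball z e. w \<noteq> z \<longrightarrow> \<Lambda>' w = 0) \<and>
    (\<forall>w\<in>ball z e. w \<noteq> z \<or> \<Lambda> z = 0 \<longrightarrow> Qlim w = g w * (w - z) powi (int (\<Lambda>' z) - int (\<Lambda> z)))"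
proof -
  define R where "R = cmod z + 1"
  have R: "R \<ge> 0" by (simp add: R_def)
  define M M' where "M = (\<Sum>\<alpha>\<in>near R. \<Gamma> \<alpha>)" and "M' = (\<Sum>\<alpha>\<in>near R. \<Gamma>' \<alpha>)"
  have M: "\<Lambda> w = count M w" if "cmod w \<le> R" for w
    using multiset_sum_eq_count_near[OF that] by (simp add: M_def)
  have M': "\<Lambda>' w = count M' w" if "cmod w \<le> R" for w
    using cluster_pair.multiset_sum_eq_count_near[OF swap that]
    by (simp add: M'_def near_def cluster_pair.near_def[OF swap] cluster_pair.sep_def[OF swap] sep_def)
  define N N' where "N = filter_mset (\<lambda>a. a \<noteq> z) M" and "N' = filter_mset (\<lambda>a. a \<noteq> z) M'"
  obtain d where d: "d > 0" "\<forall>x\<in>set_mset (M + M'). x \<noteq> z \<longrightarrow> d \<le> dist z x"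
    using finite_set_avoid[of "set_mset (M + M')" z] by auto
  define e where "e = min d 1"
  have e: "e > 0" using d by (simp add: e_def)
  have inR: "cmod w < R" if "w \<in> ball z e" for w
    using that norm_triangle_ineq2[of w z] by (auto simp: R_def e_def dist_norm norm_minus_commute)
  have nin: "w \<notin># M" "w \<notin># M'" if "w \<in> ball z e" "w \<noteq> z" for w
    using that d(2) by (auto simp: e_def)
  have ninN: "w \<notin># N" "w \<notin># N'" if "w \<in> ball z e" for w
    using nin[OF that] by (auto simp: N_def N'_def)
  have no\<Lambda>: "\<Lambda> w = 0" if "w \<in> ball z e" "w \<noteq> z \<or> \<Lambda> z = 0" for w
    using that nin(1)[OF that(1)] M[of w] inR[OF that(1)] by (cases "w = z") (auto simp: not_in_iff)
  define g where "g w = root_poly N' w / root_poly N w * far_product R w" for w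
  show ?thesis
  proof (intro exI[of _ e] exI[of _ g] conjI ballI impI e)
    have "far_product R holomorphic_on ball z e"
      using far_product_holomorphic(2)[OF R] by (rule holomorphic_on_subset) (use inR in auto)
    then show "g holomorphic_on ball z e"
      unfolding g_def using ninN by (intro holomorphic_intros) (auto simp: root_poly_eq_0_iff)
    show "g w \<noteq> 0" if "w \<in> ball z e" for w
      unfolding g_def mult_eq_0_iff divide_eq_0_iff root_poly_eq_0_iff
      using ninN[OF that] far_product_nonzero by simp
    show "\<Lambda>' w = 0" if "w \<in> ball z e" "w \<noteq> z" for w
      using that nin[OF that] M'[of w] inR[OF that(1)] by (auto simp: not_in_iff)
    fix w assume w: "w \<in> ball z e" "w \<noteq> z \<or> \<Lambda> z = 0"
    show "\<Lambda> w = 0" by (rule no\<Lambda>[OF w])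
    have zR: "cmod z \<le> R" by (simp add: R_def)
    have "(w - z) ^ count M' z / (w - z) ^ count M z = (w - z) powi (int (\<Lambda>' z) - int (\<Lambda> z))"
      using w(2) M[OF zR] M'[OF zR] by (cases "w = z") (auto simp: power_int_diff)
    moreover have "Qlim w = root_poly M' w / root_poly M w * far_product R w"
      using tendsto_Qlim(2)[OF no\<Lambda>[OF w], of R] inR[OF w(1)]
      by (simp add: cluster_factor_def prod_dividef M_def M'_def root_poly_sum)
    moreover have "root_poly M' w / root_poly M w =
        (w - z) ^ count M' z / (w - z) ^ count M z * (root_poly N' w / root_poly N w)"
      unfolding root_poly_split[where M = M and w = w and z = z] root_poly_split[where M = M' and w = w and z = z] N_def N'_def
      by (rule times_divide_times_eq[symmetric])
    ultimately show "Qlim w = g w * (w - z) powi (int (\<Lambda>' z) - int (\<Lambda> z))"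
      unfolding g_def by (simp only: mult_ac)
  qed
qed

lemma Qlim_eventually_form:
  obtains g where "g analytic_on {z}" "g z \<noteq> 0"
    "\<forall>\<^sub>F w in at z. Qlim w = g w * (w - z) powi (int (\<Lambda>' z) - int (\<Lambda> z))"
proof -
  obtain e g where g [rule_format]: "e > 0" "g holomorphic_on ball z e" "\<forall>w\<in>ball z e. g w \<noteq> 0"
    "\<forall>w\<in>ball z e. w \<noteq> z \<or> \<Lambda> z = 0 \<longrightarrow> \<Lambda> w = 0"
    "\<forall>w\<in>ball z e. w \<noteq> z \<longrightarrow> \<Lambda>' w = 0"
    "\<forall>w\<in>ball z e. w \<noteq> z \<or> \<Lambda> z = 0 \<longrightarrow> Qlim w = g w * (w - z) powi (int (\<Lambda>' z) - int (\<Lambda> z))"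
    using Qlim_local_form[of z] by (elim exE conjE) (rule that)
  show ?thesis
  proof (rule that)
    show "g analytic_on {z}" using g(1,2) by (intro holomorphic_on_imp_analytic_at[OF g(2)]) auto
    show "g z \<noteq> 0" using g(1,3) by simp
    have "\<forall>\<^sub>F w in at z. w \<in> ball z e - {z}"
      using g(1) by (intro eventually_at_in_open) auto
    then show "\<forall>\<^sub>F w in at z. Qlim w = g w * (w - z) powi (int (\<Lambda>' z) - int (\<Lambda> z))"
      by eventually_elim (simp add: g(6))
  qed
qed

lemma Qlim_meromorphic: "Qlim meromorphic_on UNIV"
proof -
  have "Qlim meromorphic_on {z}" for z
  proof -
    obtain g where g: "g analytic_on {z}" "g z \<noteq> 0"
      "\<forall>\<^sub>F w in at z. Qlim w = g w * (w - z) powi (int (\<Lambda>' z) - int (\<Lambda> z))"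
      using Qlim_eventually_form[of z] by blast
    have "(\<lambda>w. g w * (w - z) powi (int (\<Lambda>' z) - int (\<Lambda> z))) meromorphic_on {z}"
      using analytic_on_imp_meromorphic_on[OF g(1)] by (intro meromorphic_intros) auto
    then show ?thesis using g(3) by (subst meromorphic_on_cong) auto
  qed
  then show ?thesis by (subst meromorphic_on_meromorphic_at) simp
qed

lemma Q_nicely_meromorphic: "Q nicely_meromorphic_on UNIV"
  unfolding Q_eq by (rule remove_sings_nicely_meromorphic[OF Qlim_meromorphic])

lemma Q_eq_Qlim:
  assumes "\<Lambda> z = 0"
  shows "Q z = Qlim z"
proof -
  obtain e g where g [rule_format]: "e > 0" "g holomorphic_on ball z e" "\<forall>w\<in>ball z e. g w \<noteq> 0"
    "\<forall>w\<in>ball z e. w \<noteq> z \<or> \<Lambda> z = 0 \<longrightarrow> \<Lambda> w = 0"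
    "\<forall>w\<in>ball z e. w \<noteq> z \<longrightarrow> \<Lambda>' w = 0"
    "\<forall>w\<in>ball z e. w \<noteq> z \<or> \<Lambda> z = 0 \<longrightarrow> Qlim w = g w * (w - z) powi (int (\<Lambda>' z) - int (\<Lambda> z))"
    using Qlim_local_form[of z] by (elim exE conjE) (rule that)
  have "(\<lambda>w. g w * (w - z) ^ \<Lambda>' z) holomorphic_on ball z e"
    using g(2) by (intro holomorphic_intros)
  then have "Qlim holomorphic_on ball z e"
    by (rule holomorphic_transform) (simp add: g(6) assms)
  then have "Qlim analytic_on {z}" using g(1) by (auto intro: holomorphic_on_imp_analytic_at)
  then show ?thesis unfolding Q_eq by simp
qed

lemma eventually_off_\<Lambda>: "\<forall>\<^sub>F w in at z. \<Lambda> w = 0 \<and> \<Lambda>' w = 0"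
proof -
  obtain e g where g [rule_format]: "e > 0" "g holomorphic_on ball z e" "\<forall>w\<in>ball z e. g w \<noteq> 0"
    "\<forall>w\<in>ball z e. w \<noteq> z \<or> \<Lambda> z = 0 \<longrightarrow> \<Lambda> w = 0"
    "\<forall>w\<in>ball z e. w \<noteq> z \<longrightarrow> \<Lambda>' w = 0"
    "\<forall>w\<in>ball z e. w \<noteq> z \<or> \<Lambda> z = 0 \<longrightarrow> Qlim w = g w * (w - z) powi (int (\<Lambda>' z) - int (\<Lambda> z))"
    using Qlim_local_form[of z] by (elim exE conjE) (rule that)
  have "\<forall>\<^sub>F w in at z. w \<in> ball z e - {z}"
    using g(1) by (intro eventually_at_in_open) auto
  then show ?thesis by eventually_elim (use g(4,5) in simp)
qed

lemma eventually_Q_eq_Qlim: "\<forall>\<^sub>F w in at z. Q w = Qlim w"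
  using eventually_off_\<Lambda> by (rule eventually_mono) (simp add: Q_eq_Qlim)

lemma zorder_Q: "zorder Q z = int (\<Lambda>' z) - int (\<Lambda> z)"
proof -
  obtain e g where g [rule_format]: "e > 0" "g holomorphic_on ball z e" "\<forall>w\<in>ball z e. g w \<noteq> 0"
    "\<forall>w\<in>ball z e. w \<noteq> z \<or> \<Lambda> z = 0 \<longrightarrow> \<Lambda> w = 0"
    "\<forall>w\<in>ball z e. w \<noteq> z \<longrightarrow> \<Lambda>' w = 0"
    "\<forall>w\<in>ball z e. w \<noteq> z \<or> \<Lambda> z = 0 \<longrightarrow> Qlim w = g w * (w - z) powi (int (\<Lambda>' z) - int (\<Lambda> z))"
    using Qlim_local_form[of z] by (elim exE conjE) (rule that)
  show ?thesis
    by (rule zorder_eqI[where S = "ball z e" and g = g]) (use g(1-3) in \<open>simp_all add: Q_eq_Qlim g(4,6)\<close>)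
qed

lemma uniform_limit_Q:
  assumes "compact K" "\<forall>z\<in>K. \<Lambda> z = 0"
  shows "uniform_limit K (\<lambda>F z. \<Prod>\<alpha>\<in>F. factor \<alpha> z) Q (finite_subsets_at_top I)"
proof -
  obtain R where R: "R \<ge> 0" "K \<subseteq> cball 0 R"
    using bounded_subset_ballD[OF compact_imp_bounded[OF assms(1)], of 0] ball_subset_cball[of "0::complex"]
    by (meson less_imp_le order_trans)
  have "uniform_limit K (\<lambda>F z. \<Prod>\<alpha>\<in>F. factor \<alpha> z)
     (\<lambda>z. (\<Prod>\<alpha>\<in>near R. factor \<alpha> z) * far_product R z) (finite_subsets_at_top I)"
    using assms R by (intro uniform_limit_product) auto
  then show ?thesis
    by (rule uniform_limit_cong[THEN iffD1, rotated 2])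
      (use assms R tendsto_Qlim(2) in \<open>auto simp: Q_eq_Qlim\<close>)
qed

text \<open>
  Factor by factor the two products are inverse to each other, and both converge.
\<close>
lemma Qlim_mult_swap:
  assumes "\<Lambda> z = 0" "\<Lambda>' z = 0"
  shows "cluster_pair.Qlim I \<Gamma>' \<Gamma> z * Qlim z = 1"
proof -
  have "((\<lambda>F. (\<Prod>\<alpha>\<in>F. cluster_factor (\<Gamma>' \<alpha>) (\<Gamma> \<alpha>) z) * (\<Prod>\<alpha>\<in>F. factor \<alpha> z)) \<longlongrightarrow>
      cluster_pair.Qlim I \<Gamma>' \<Gamma> z * Qlim z) (finite_subsets_at_top I)"
    using assms by (intro tendsto_mult tendsto_Qlim cluster_pair.tendsto_Qlim[OF swap]) auto
  moreover have "\<forall>\<^sub>F F in finite_subsets_at_top I.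
      (\<Prod>\<alpha>\<in>F. cluster_factor (\<Gamma>' \<alpha>) (\<Gamma> \<alpha>) z) * (\<Prod>\<alpha>\<in>F. factor \<alpha> z) = 1"
  proof (intro eventually_finite_subsets_at_top_weakI)
    fix F assume "finite F" "F \<subseteq> I"
    then have "cluster_factor (\<Gamma>' \<alpha>) (\<Gamma> \<alpha>) z * factor \<alpha> z = 1" if "\<alpha> \<in> F" for \<alpha>
      using that assms cluster_pair.multiset_sum_eq_0_iff[OF swap] multiset_sum_eq_0_iff
      by (auto simp: cluster_factor_def root_poly_eq_0_iff)
    then show "(\<Prod>\<alpha>\<in>F. cluster_factor (\<Gamma>' \<alpha>) (\<Gamma> \<alpha>) z) * (\<Prod>\<alpha>\<in>F. factor \<alpha> z) = 1"
      by (simp flip: prod.distrib)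
  qed
  ultimately have "((\<lambda>F. 1) \<longlongrightarrow> cluster_pair.Qlim I \<Gamma>' \<Gamma> z * Qlim z) (finite_subsets_at_top I)"
    by (rule Lim_transform_eventually)
  then show ?thesis
    using tendsto_unique[OF finite_subsets_at_top_neq_bot] tendsto_const by blast
qed

section \<open>The multiplication operator\<close>

abbreviation "T \<equiv> mult_operator Q"

text \<open>
  Membership in the vanishing space without the integrability: everything algebraic about the
  multiplication operator already holds for these functions.
\<close>
definition vanishes :: "(complex \<Rightarrow> complex) \<Rightarrow> bool" where
  "vanishes f \<longleftrightarrow> f holomorphic_on UNIV \<and> ((\<forall>z. f z = 0) \<or> (\<forall>z. \<Lambda> z \<le> zero_multiset f z))"

text \<open>
  The entire function \<open>T f\<close> is determined by its values off a discrete set. Linearity and invertibility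
  of \<open>T\<close> follow from this, because they hold for multiplication by \<open>Qlim\<close> off \<open>\<Lambda>\<close> and \<open>\<Lambda>'\<close>.
\<close>
lemma T_eqI:
  assumes "u holomorphic_on UNIV" "\<And>z. \<forall>\<^sub>F w in at z. u w = Qlim w * f w"
  shows "T f = u"
proof
  fix z
  have "\<forall>\<^sub>F w in at z. Q w * f w = u w"
    using eventually_Q_eq_Qlim[of z] assms(2)[of z] by eventually_elim simp
  then show "T f z = u z"
    unfolding mult_operator_def by (intro remove_sings_eq_holomorphic[OF open_UNIV assms(1)]) auto
qed

text \<open>
  The pole of \<open>Q\<close> at \<open>z\<close> has order at most \<open>\<Lambda> z\<close>, and \<open>f\<close> vanishes there at least to this order, so
  the exponents add up to a natural number.
\<close>
lemma T_local_form:
  assumes "vanishes f" "f w0 \<noteq> 0"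
  shows "\<exists>e>0. \<exists>h. h holomorphic_on ball z e \<and> (\<forall>w\<in>ball z e. h w \<noteq> 0) \<and>
    (\<forall>w\<in>ball z e. T f w = h w * (w - z) ^ (\<Lambda>' z + zero_multiset f z - \<Lambda> z)) \<and>
    (\<forall>w\<in>ball z e. w \<noteq> z \<or> \<Lambda> z = 0 \<longrightarrow> T f w = Qlim w * f w)"
proof -
  have f: "f holomorphic_on UNIV" "\<And>z. \<Lambda> z \<le> zero_multiset f z"
    using assms by (auto simp: vanishes_def)
  obtain d k where k [rule_format]: "d > 0" "k holomorphic_on ball z d" "\<forall>x\<in>ball z d. k x \<noteq> 0"
    "\<forall>x\<in>ball z d. f x = k x * (x - z) ^ nat (zorder f z)"
    "zorder f z = int (nat (zorder f z))" "f z = 0 \<longleftrightarrow> zorder f z > 0"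
    using entire_local_factor[OF f(1) assms(2), of z] by (elim exE conjE) (rule that)
  obtain e g where g [rule_format]: "e > 0" "g holomorphic_on ball z e" "\<forall>w\<in>ball z e. g w \<noteq> 0"
    "\<forall>w\<in>ball z e. w \<noteq> z \<or> \<Lambda> z = 0 \<longrightarrow> \<Lambda> w = 0"
    "\<forall>w\<in>ball z e. w \<noteq> z \<longrightarrow> \<Lambda>' w = 0"
    "\<forall>w\<in>ball z e. w \<noteq> z \<or> \<Lambda> z = 0 \<longrightarrow> Qlim w = g w * (w - z) powi (int (\<Lambda>' z) - int (\<Lambda> z))"
    using Qlim_local_form[of z] by (elim exE conjE) (rule that)
  define D where "D = ball z (min d e)"
  define n where "n = \<Lambda>' z + zero_multiset f z - \<Lambda> z"
  define F where "F w = g w * k w * (w - z) ^ n" for w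
  have hol: "(\<lambda>w. g w * k w) holomorphic_on D"
    unfolding D_def by (intro holomorphic_intros holomorphic_on_subset[OF g(2)] holomorphic_on_subset[OF k(2)]) auto
  then have F: "F holomorphic_on D"
    unfolding F_def by (rule holomorphic_on_mult) (intro holomorphic_intros)
  have eq: "Qlim w * f w = F w" if "w \<in> D" "w \<noteq> z \<or> \<Lambda> z = 0" for w
  proof -
    have "Qlim w * f w = g w * k w * ((w - z) powi (int (\<Lambda>' z) - int (\<Lambda> z)) * (w - z) ^ zero_multiset f z)"
      using that g(6)[of w] k(4)[of w] by (simp add: D_def zero_multiset_def)
    also have "(w - z) powi (int (\<Lambda>' z) - int (\<Lambda> z)) * (w - z) ^ zero_multiset f z = (w - z) ^ n"
    proof (cases "w = z")
      case True
      then show ?thesis using that by (simp add: n_def flip: power_add)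
    next
      case False
      have "int (\<Lambda>' z) - int (\<Lambda> z) + int (zero_multiset f z) = int n"
        using f(2)[of z] by (simp add: n_def)
      then show ?thesis using False
        by (metis power_int_add power_int_of_nat right_minus_eq)
    qed
    finally show ?thesis by (simp add: F_def)
  qed
  have TF: "T f w = F w" if "w \<in> D" for w
    unfolding mult_operator_def
  proof (rule remove_sings_eq_holomorphic[OF _ F that])
    show "open D" by (simp add: D_def)
    have "\<forall>\<^sub>F x in at w. x \<in> D - {z} \<or> (x \<in> D \<and> x \<noteq> w \<and> w = z)"
    proof (cases "w = z")
      case True
      have "\<forall>\<^sub>F x in at w. x \<in> D - {w}"
        using that by (intro eventually_at_in_open) (auto simp: D_def)
      then show ?thesis by eventually_elim (use True in auto)
    next
      case False
      have "\<forall>\<^sub>F x in at w. x \<in> (D - {z}) - {w}"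
        using that False by (intro eventually_at_in_open) (auto simp: D_def)
      then show ?thesis by eventually_elim auto
    qed
    then show "\<forall>\<^sub>F x in at w. Q x * f x = F x"
    proof eventually_elim
      case (elim x)
      then have x: "x \<in> D" "x \<noteq> z" by auto
      then show ?case using eq[OF x(1)] g(4)[of x] by (simp add: Q_eq_Qlim D_def)
    qed
  qed
  show ?thesis
  proof (intro exI[of _ "min d e"] exI[of _ "\<lambda>w. g w * k w"] conjI ballI impI)
    show "T f w = Qlim w * f w" if "w \<in> ball z (min d e)" "w \<noteq> z \<or> \<Lambda> z = 0" for w
      using that TF[of w] eq[of w] by (simp add: D_def)
  qed (use k(1,3) g(1,3) hol TF in \<open>auto simp: D_def F_def n_def\<close>)
qed

lemma T_zero:
  assumes "\<forall>z. f z = 0"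
  shows "T f = (\<lambda>z. 0)"
  using assms by (intro T_eqI) auto

lemma T_holomorphic:
  assumes "vanishes f"
  shows "T f holomorphic_on UNIV"
proof (cases "\<forall>z. f z = 0")
  case False
  then obtain w0 where w0: "f w0 \<noteq> 0" by auto
  show ?thesis
  proof (rule analytic_imp_holomorphic, subst analytic_on_analytic_at, rule ballI)
    fix z
    obtain e h where h [rule_format]: "e > 0" "h holomorphic_on ball z e" "\<forall>w\<in>ball z e. h w \<noteq> 0"
    "\<forall>w\<in>ball z e. T f w = h w * (w - z) ^ (\<Lambda>' z + zero_multiset f z - \<Lambda> z)"
    "\<forall>w\<in>ball z e. w \<noteq> z \<or> \<Lambda> z = 0 \<longrightarrow> T f w = Qlim w * f w"
    using T_local_form[OF assms w0, of z] by (elim exE conjE) (rule that)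
    have "(\<lambda>w. h w * (w - z) ^ (\<Lambda>' z + zero_multiset f z - \<Lambda> z)) holomorphic_on ball z e"
      using h(2) by (intro holomorphic_intros)
    then have "T f holomorphic_on ball z e"
      by (rule holomorphic_transform) (simp add: h(4))
    then show "T f analytic_on {z}" using h(1) by (auto intro: holomorphic_on_imp_analytic_at)
  qed
qed (simp add: T_zero)

lemma T_eq:
  assumes "vanishes f" "\<Lambda> z = 0"
  shows "T f z = Qlim z * f z"
proof (cases "\<forall>z. f z = 0")
  case False
  then obtain w0 where w0: "f w0 \<noteq> 0" by auto
  obtain e h where h [rule_format]: "e > 0" "h holomorphic_on ball z e" "\<forall>w\<in>ball z e. h w \<noteq> 0"
    "\<forall>w\<in>ball z e. T f w = h w * (w - z) ^ (\<Lambda>' z + zero_multiset f z - \<Lambda> z)"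
    "\<forall>w\<in>ball z e. w \<noteq> z \<or> \<Lambda> z = 0 \<longrightarrow> T f w = Qlim w * f w"
    using T_local_form[OF assms(1) w0, of z] by (elim exE conjE) (rule that)
  show ?thesis using h(5)[of z] h(1) assms(2) by simp
qed (simp add: T_zero)

lemma zero_multiset_T:
  assumes "vanishes f" "f w0 \<noteq> 0"
  shows "zero_multiset (T f) z = \<Lambda>' z + zero_multiset f z - \<Lambda> z" "\<exists>w. T f w \<noteq> 0"
proof -
  obtain e h where h [rule_format]: "e > 0" "h holomorphic_on ball z e" "\<forall>w\<in>ball z e. h w \<noteq> 0"
    "\<forall>w\<in>ball z e. T f w = h w * (w - z) ^ (\<Lambda>' z + zero_multiset f z - \<Lambda> z)"
    "\<forall>w\<in>ball z e. w \<noteq> z \<or> \<Lambda> z = 0 \<longrightarrow> T f w = Qlim w * f w"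
    using T_local_form[OF assms, of z] by (elim exE conjE) (rule that)
  have "zorder (T f) z = int (\<Lambda>' z + zero_multiset f z - \<Lambda> z)"
    by (rule zorder_eqI[where S = "ball z e" and g = h]) (use h(1-3) in \<open>simp_all add: h(4)\<close>)
  then show "zero_multiset (T f) z = \<Lambda>' z + zero_multiset f z - \<Lambda> z"
    by (simp add: zero_multiset_def)
  have "z + of_real (e / 2) \<in> ball z e" using h(1) by (simp add: dist_norm)
  from h(3)[OF this] h(4)[OF this] h(1) show "\<exists>w. T f w \<noteq> 0"
    by (intro exI[of _ "z + of_real (e / 2)"]) simp
qed

lemma T_vanishes:
  assumes "vanishes f"
  shows "cluster_pair.vanishes I \<Gamma>' (T f)"
proof (cases "\<forall>z. f z = 0")
  case True
  then show ?thesis by (simp add: T_zero cluster_pair.vanishes_def[OF swap])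
next
  case False
  then obtain w0 where w0: "f w0 \<noteq> 0" by auto
  have le: "\<Lambda> z \<le> zero_multiset f z" for z using assms w0 by (auto simp: vanishes_def)
  have "\<Lambda>' z \<le> zero_multiset (T f) z" for z
    using le[of z] zero_multiset_T(1)[OF assms w0, of z] by simp
  then show ?thesis
    using T_holomorphic[OF assms] by (simp add: cluster_pair.vanishes_def[OF swap])
qed

lemma T_swap_T:
  assumes "vanishes f"
  shows "mult_operator (cluster_product I \<Gamma>' \<Gamma>) (T f) = f"
proof (rule cluster_pair.T_eqI[OF swap])
  show "f holomorphic_on UNIV" using assms by (simp add: vanishes_def)
  fix z
  show "\<forall>\<^sub>F w in at z. f w = cluster_pair.Qlim I \<Gamma>' \<Gamma> w * T f w"
    using eventually_off_\<Lambda>[of z]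
  proof eventually_elim
    case (elim w)
    then show ?case
      using Qlim_mult_swap[of w] by (simp add: T_eq[OF assms] flip: mult.assoc)
  qed
qed

lemma T_linear_combination:
  assumes "finite A" "\<And>b. b \<in> A \<Longrightarrow> vanishes b" "\<And>z. v z = (\<Sum>b\<in>A. a b * b z)"
  shows "T v = (\<lambda>z. \<Sum>b\<in>A. a b * T b z)"
proof (rule T_eqI)
  show "(\<lambda>z. \<Sum>b\<in>A. a b * T b z) holomorphic_on UNIV"
    using assms(2) by (intro holomorphic_intros T_holomorphic)
  fix z
  show "\<forall>\<^sub>F w in at z. (\<Sum>b\<in>A. a b * T b w) = Qlim w * v w"
    using eventually_off_\<Lambda>[of z]
    by eventually_elim (simp add: assms(3) sum_distrib_left T_eq[OF assms(2)] mult_ac)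
qed

lemma T_add:
  assumes "vanishes f" "vanishes g"
  shows "T (\<lambda>z. f z + g z) = (\<lambda>z. T f z + T g z)"
proof (rule T_eqI)
  show "(\<lambda>z. T f z + T g z) holomorphic_on UNIV"
    using assms by (intro holomorphic_intros T_holomorphic)
  fix z
  show "\<forall>\<^sub>F w in at z. T f w + T g w = Qlim w * (f w + g w)"
    using eventually_off_\<Lambda>[of z] by eventually_elim (simp add: T_eq assms algebra_simps)
qed

lemma T_scale:
  assumes "vanishes f"
  shows "T (\<lambda>z. a * f z) = (\<lambda>z. a * T f z)"
proof (rule T_eqI)
  show "(\<lambda>z. a * T f z) holomorphic_on UNIV"
    using assms by (intro holomorphic_intros T_holomorphic)
  fix z
  show "\<forall>\<^sub>F w in at z. a * T f w = Qlim w * (a * f w)"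
    using eventually_off_\<Lambda>[of z] by eventually_elim (simp add: T_eq assms algebra_simps)
qed

end

section \<open>Boundedness in the Fock norm\<close>

abbreviation fock_density :: "(complex \<Rightarrow> complex) \<Rightarrow> complex \<Rightarrow> real" where
  "fock_density f z \<equiv> (cmod (f z))\<^sup>2 * exp (- (cmod z)\<^sup>2)"

text \<open>
  This is \<open>|\<zeta>|\<^sup>2 = |z|\<^sup>2 + 2 Re (cnj z * (\<zeta> - z)) + |\<zeta> - z|\<^sup>2\<close>. On a circle around \<open>z\<close> the last term is
  constant, so the Gaussian weight is, up to a constant, the squared modulus of an entire function
  without zeros. The mean value property therefore holds for the weighted densities with a constant
  not depending on \<open>z\<close>.
\<close>
lemma gaussian_twist:
  fixes z \<zeta> :: complex
  shows "(cmod (exp (- cnj z * (\<zeta> - z))))\<^sup>2 = exp (- (cmod \<zeta>)\<^sup>2) * exp ((cmod z)\<^sup>2 + (cmod (\<zeta> - z))\<^sup>2)"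
proof -
  have "2 * Re (- cnj z * (\<zeta> - z)) = - (cmod \<zeta>)\<^sup>2 + ((cmod z)\<^sup>2 + (cmod (\<zeta> - z))\<^sup>2)"
    by (simp only: cmod_power2) (simp add: power2_eq_square algebra_simps)
  then show ?thesis
    by (simp only: norm_exp_eq_Re flip: exp_double exp_add)
qed

lemma continuous_density:
  assumes "f holomorphic_on UNIV"
  shows "continuous_on UNIV (fock_density f)"
  using holomorphic_on_imp_continuous_on[OF assms] by (intro continuous_intros)

context cluster_pair begin

text \<open>
  The function \<open>Q\<close> itself is not bounded near a cluster, and the number of clusters near a point has no
  uniform bound, so \<open>T f\<close> cannot be estimated by \<open>f\<close> at the same point. It is estimated by \<open>f\<close> on a
  circle around \<open>z\<close> instead. Let \<open>N\<close> be the set of clusters with centre within \<open>sep\<close> of \<open>z\<close>. The function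
  \<open>f\<close> times the product of the factors in \<open>N\<close> is entire, so its value at \<open>z\<close> is at most its average
  over the circle of radius \<open>2 * sep\<close>. That circle is far from all clusters in \<open>N\<close>, and so the product
  is bounded on it; and \<open>z\<close> is far from all clusters not in \<open>N\<close>, so these contribute a bounded
  factor at \<open>z\<close>.
\<close>
lemma density_T_le_circle_average:
  obtains C where "C > 0"
    "\<And>f z. vanishes f \<Longrightarrow> \<Lambda> z = 0 \<Longrightarrow> ennreal (fock_density (T f) z) \<le>
       ennreal C * (\<integral>\<^sup>+t\<in>{0..1}. ennreal (fock_density f (circlepath z (2 * sep) t)) \<partial>lborel)"
proof -
  obtain B where B: "B > 0"
    "\<And>z F. finite F \<Longrightarrow> F \<subseteq> I \<Longrightarrow> (\<And>\<alpha>. \<alpha> \<in> F \<Longrightarrow> cmod (z - c \<alpha>) \<ge> sep) \<Longrightarrow>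
       cmod (\<Prod>\<alpha>\<in>F. factor \<alpha> z) \<le> B"
    using norm_prod_factor_bounded by blast
  define \<rho> where "\<rho> = 2 * sep"
  have \<rho>: "\<rho> > 0" using sep(1) by (simp add: \<rho>_def)
  define C where "C = B ^ 4 * exp (\<rho>\<^sup>2)"
  show ?thesis
  proof (rule that)
    show "C > 0" using B by (simp add: C_def)
  next
    fix f z assume f: "vanishes f" and z: "\<Lambda> z = 0"
    have holf: "f holomorphic_on UNIV" using f by (simp add: vanishes_def)
    define N where "N = {\<alpha>\<in>I. cmod (z - c \<alpha>) < sep}"
    have N_near: "N \<subseteq> near R" if "cmod z \<le> R" for R
    proof
      fix \<alpha> assume "\<alpha> \<in> N"
      then show "\<alpha> \<in> near R"
        using norm_triangle_ineq2[of "c \<alpha>" z] that by (auto simp: N_def near_def norm_minus_commute)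
    qed
    have N: "finite N" "N \<subseteq> I"
      using N_near[OF order_refl] finite_near by (auto simp: N_def intro: finite_subset)
    define M M' where "M = (\<Sum>\<alpha>\<in>N. \<Gamma> \<alpha>)" and "M' = (\<Sum>\<alpha>\<in>N. \<Gamma>' \<alpha>)"
    have prodN: "(\<Prod>\<alpha>\<in>N. factor \<alpha> w) = root_poly M' w / root_poly M w" for w
      by (simp add: cluster_factor_def prod_dividef M_def M'_def root_poly_sum)
    have count_le: "count M w \<le> \<Lambda> w" for w
    proof -
      have "count M w \<le> (\<Sum>\<alpha>\<in>near (max (cmod z) (cmod w)). count (\<Gamma> \<alpha>) w)"
        unfolding M_def count_sum using N_near finite_near by (intro sum_mono2) auto
      then show ?thesis
        using multiset_sum_eq_count_near[of w "max (cmod z) (cmod w)"] by (simp add: count_sum)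
    qed
    \<comment> \<open>The poles of the near factors are cancelled: the product of these factors and \<open>f\<close> is
      \<open>root_poly M' w * g w\<close>.\<close>
    obtain g where g: "g holomorphic_on UNIV" "\<And>w. f w = root_poly M w * g w"
    proof (cases "\<forall>w. f w = 0")
      case True
      then show ?thesis by (intro that[of "\<lambda>w. 0"]) auto
    next
      case False
      then obtain w0 where w0: "f w0 \<noteq> 0" by auto
      have "int (count M w) \<le> zorder f w" for w
      proof -
        have "count M w \<le> nat (zorder f w)"
          using f w0 count_le[of w] by (auto simp: vanishes_def zero_multiset_def intro: order_trans)
        moreover have "zorder f w = int (nat (zorder f w))"
          using entire_local_factor[OF holf w0, of w] by (elim exE conjE)
        ultimately show ?thesis by linarith
      qed
      from entire_divide_finite_zeros[OF holf w0 this] show ?thesis using that by blast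
    qed
    \<comment> \<open>The mean value property is applied to a square, because the density contains \<open>|f|\<^sup>2\<close>.\<close>
    define k where "k w = (root_poly M' w * g w * exp (- cnj z * (w - z)))\<^sup>2" for w
    have hol: "k holomorphic_on UNIV"
      unfolding k_def by (intro holomorphic_intros g)
    \<comment> \<open>On the circle the clusters in \<open>N\<close> are far away, and there \<open>root_poly M' w * g w\<close> is \<open>f w\<close> times the
      product of their factors.\<close>
    have circle: "norm (k w) \<le> B\<^sup>2 * exp ((cmod z)\<^sup>2 + \<rho>\<^sup>2) * fock_density f w" if w: "cmod (w - z) = \<rho>" for w
    proof -
      have far: "cmod (w - c \<alpha>) \<ge> sep" if "\<alpha> \<in> N" for \<alpha>
        using that w norm_triangle_ineq[of "w - c \<alpha>" "c \<alpha> - z"] by (auto simp: N_def \<rho>_def norm_minus_commute)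
      have nz: "root_poly M w \<noteq> 0"
        unfolding M_def root_poly_sum prod_zero_iff[OF N(1)] root_poly_eq_0_iff
        using far away_from_cluster(1) N(2) by blast
      have "cmod (root_poly M' w * g w) = cmod (\<Prod>\<alpha>\<in>N. factor \<alpha> w) * cmod (f w)"
        unfolding prodN g(2) using nz by (simp add: norm_mult norm_divide)
      also have "\<dots> \<le> B * cmod (f w)"
        using B(2)[OF N far] by (intro mult_right_mono) auto
      finally have "(cmod (root_poly M' w * g w))\<^sup>2 \<le> (B * cmod (f w))\<^sup>2"
        by (intro power_mono) auto
      then have "(cmod (root_poly M' w * g w))\<^sup>2 * (cmod (exp (- cnj z * (w - z))))\<^sup>2
          \<le> (B * cmod (f w))\<^sup>2 * (cmod (exp (- cnj z * (w - z))))\<^sup>2"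
        by (intro mult_right_mono) auto
      then show ?thesis
        unfolding gaussian_twist w k_def norm_power norm_mult power_mult_distrib by (simp add: mult_ac)
    qed
    \<comment> \<open>At the centre only the clusters outside \<open>N\<close> are left, and all of them are far away; the bound for
      their finite products passes to the limit.\<close>
    have centre: "cmod (T f z) \<le> B * cmod (root_poly M' z * g z)"
    proof -
      have "((\<lambda>F. cmod (\<Prod>\<alpha>\<in>F. factor \<alpha> z)) \<longlongrightarrow> cmod (Qlim z)) (finite_subsets_at_top I)"
        by (intro tendsto_norm tendsto_Qlim[OF z order_refl])
      moreover have "\<forall>\<^sub>F F in finite_subsets_at_top I.
          cmod (\<Prod>\<alpha>\<in>F. factor \<alpha> z) \<le> B * cmod (\<Prod>\<alpha>\<in>N. factor \<alpha> z)"
        unfolding eventually_finite_subsets_at_top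
      proof (intro exI[of _ N] conjI N allI impI)
        fix F assume F: "finite F \<and> N \<subseteq> F \<and> F \<subseteq> I"
        have "(\<Prod>\<alpha>\<in>F. factor \<alpha> z) = (\<Prod>\<alpha>\<in>F - N. factor \<alpha> z) * (\<Prod>\<alpha>\<in>N. factor \<alpha> z)"
          using F by (intro prod.subset_diff) auto
        moreover have "cmod (\<Prod>\<alpha>\<in>F - N. factor \<alpha> z) \<le> B"
          using F by (intro B(2)) (auto simp: N_def not_less)
        ultimately show "cmod (\<Prod>\<alpha>\<in>F. factor \<alpha> z) \<le> B * cmod (\<Prod>\<alpha>\<in>N. factor \<alpha> z)"
          by (simp add: norm_mult mult_right_mono)
      qed
      ultimately have "cmod (Qlim z) \<le> B * cmod (\<Prod>\<alpha>\<in>N. factor \<alpha> z)"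
        by (rule tendsto_upperbound) simp
      then have "cmod (Qlim z) * cmod (f z) \<le> B * cmod (\<Prod>\<alpha>\<in>N. factor \<alpha> z) * cmod (f z)"
        by (intro mult_right_mono) auto
      moreover have "root_poly M z \<noteq> 0"
        unfolding root_poly_eq_0_iff using count_le[of z] z by (simp add: not_in_iff)
      ultimately show ?thesis
        unfolding prodN g(2) T_eq[OF f z] by (simp add: norm_mult norm_divide mult_ac)
    qed
    define J where "J = (\<integral>\<^sup>+t\<in>{0..1}. ennreal (fock_density f (circlepath z \<rho> t)) \<partial>lborel)"
    define D where "D = B\<^sup>2 * exp ((cmod z)\<^sup>2 + \<rho>\<^sup>2)"
    have [measurable]: "(\<lambda>t. fock_density f (circlepath z \<rho> t)) \<in> borel_measurable borel"
    proof (intro borel_measurable_continuous_onI continuous_on_compose2[OF continuous_density[OF holf]])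
      show "continuous_on UNIV (circlepath z \<rho>)" unfolding circlepath by (intro continuous_intros)
    qed auto
    have "ennreal (norm (k z)) \<le> (\<integral>\<^sup>+t\<in>{0..1}. ennreal (norm (k (circlepath z \<rho> t))) \<partial>lborel)"
      by (rule norm_le_circle_integral[OF hol \<rho>])
    also have "\<dots> \<le> (\<integral>\<^sup>+t. ennreal D * (ennreal (fock_density f (circlepath z \<rho> t)) * indicator {0..1} t) \<partial>lborel)"
    proof (rule nn_integral_mono)
      fix t :: real
      have "norm (k (circlepath z \<rho> t)) \<le> D * fock_density f (circlepath z \<rho> t)"
        unfolding D_def using \<rho> by (intro circle) (simp add: circlepath norm_mult)
      then show "ennreal (norm (k (circlepath z \<rho> t))) * indicator {0..1} t
          \<le> ennreal D * (ennreal (fock_density f (circlepath z \<rho> t)) * indicator {0..1} t)"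
        using B by (simp add: D_def indicator_def flip: ennreal_mult)
    qed
    also have "\<dots> = ennreal D * J"
      unfolding J_def by (rule nn_integral_cmult) measurable
    finally have kz: "ennreal (norm (k z)) \<le> ennreal D * J" .
    have "fock_density (T f) z \<le> (B * cmod (root_poly M' z * g z))\<^sup>2 * exp (- (cmod z)\<^sup>2)"
      using centre by (intro mult_right_mono power_mono) auto
    also have "\<dots> = (B\<^sup>2 * exp (- (cmod z)\<^sup>2)) * norm (k z)"
      by (simp add: k_def norm_power norm_mult power_mult_distrib)
    finally have "ennreal (fock_density (T f) z) \<le> ennreal (B\<^sup>2 * exp (- (cmod z)\<^sup>2)) * ennreal (norm (k z))"
      by (simp add: ennreal_leI flip: ennreal_mult)
    also have "\<dots> \<le> ennreal (B\<^sup>2 * exp (- (cmod z)\<^sup>2)) * (ennreal D * J)"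
      by (intro mult_left_mono kz) auto
    also have "\<dots> = ennreal (B\<^sup>2 * exp (- (cmod z)\<^sup>2) * D) * J"
      using B by (simp add: D_def ennreal_mult mult.assoc)
    also have "B\<^sup>2 * exp (- (cmod z)\<^sup>2) * D = C"
      by (simp add: C_def D_def exp_add exp_minus field_simps power2_eq_square power4_eq_xxxx)
    finally show "ennreal (fock_density (T f) z) \<le>
       ennreal C * (\<integral>\<^sup>+t\<in>{0..1}. ennreal (fock_density f (circlepath z (2 * sep) t)) \<partial>lborel)"
      by (simp add: J_def \<rho>_def)
  qed
qed

lemma AE_off_\<Lambda>: "AE z in lborel. \<Lambda> z = 0"
proof -
  have "{z. \<Lambda> z \<noteq> 0} \<subseteq> (\<Union>n. set_mset (\<Sum>\<alpha>\<in>near (real n). \<Gamma> \<alpha>))"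
  proof
    fix z assume z: "z \<in> {z. \<Lambda> z \<noteq> 0}"
    obtain n :: nat where "cmod z \<le> n" using real_arch_simple by blast
    then have "z \<in># (\<Sum>\<alpha>\<in>near (real n). \<Gamma> \<alpha>)"
      using z multiset_sum_eq_count_near[of z n] by (simp add: not_in_iff del: count_sum)
    then show "z \<in> (\<Union>n. set_mset (\<Sum>\<alpha>\<in>near (real n). \<Gamma> \<alpha>))" by blast
  qed
  then have "countable {z. \<Lambda> z \<noteq> 0}"
    by (rule countable_subset) (intro countable_UN countable_finite finite_set_mset countableI_type)
  then have "{z. \<Lambda> z \<noteq> 0} \<in> null_sets lborel"
    by (rule countable_imp_null_set_lborel)
  from AE_not_in[OF this] show ?thesis by simp
qed

text \<open>
  Off the null set \<open>\<Lambda>\<close> the density of \<open>T f\<close> is bounded by circle averages of the density of \<open>f\<close>, and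
  these averages preserve the total integral.
\<close>
lemma T_bounded:
  obtains C where "\<And>f. f \<in> fock \<Longrightarrow> vanishes f \<Longrightarrow> T f \<in> fock \<and> fock_norm (T f) \<le> C * fock_norm f"
proof -
  obtain C where C: "C > 0"
    "\<And>f z. vanishes f \<Longrightarrow> \<Lambda> z = 0 \<Longrightarrow> ennreal (fock_density (T f) z) \<le>
       ennreal C * (\<integral>\<^sup>+t\<in>{0..1}. ennreal (fock_density f (circlepath z (2 * sep) t)) \<partial>lborel)"
    using density_T_le_circle_average by blast
  show ?thesis
  proof (rule that)
    fix f assume f: "f \<in> fock" "vanishes f"
    have holf: "f holomorphic_on UNIV" and intf: "integrable lborel (fock_density f)"
      using f by (auto simp: fock_def)
    have holT: "T f holomorphic_on UNIV" by (rule T_holomorphic[OF f(2)])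
    have [measurable]: "fock_density f \<in> borel_measurable borel" "fock_density (T f) \<in> borel_measurable borel"
      by (intro borel_measurable_continuous_onI continuous_density holf holT)+
    have [measurable]: "(\<lambda>(z, t). circlepath z (2 * sep) t) \<in> borel_measurable (borel \<Otimes>\<^sub>M borel)"
      unfolding borel_prod circlepath case_prod_unfold
      by (intro borel_measurable_continuous_onI continuous_intros)
    have "(\<integral>\<^sup>+z. ennreal (fock_density (T f) z) \<partial>lborel) \<le>
        (\<integral>\<^sup>+z. ennreal C * (\<integral>\<^sup>+t\<in>{0..1}. ennreal (fock_density f (circlepath z (2 * sep) t)) \<partial>lborel) \<partial>lborel)"
      using AE_off_\<Lambda> by (intro nn_integral_mono_AE) (auto elim!: eventually_mono intro: C(2)[OF f(2)])
    also have "\<dots> = ennreal C * (\<integral>\<^sup>+z. (\<integral>\<^sup>+t\<in>{0..1}. ennreal (fock_density f (circlepath z (2 * sep) t)) \<partial>lborel) \<partial>lborel)"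
      by (intro nn_integral_cmult) measurable
    also have "\<dots> = ennreal C * (\<integral>\<^sup>+z. ennreal (fock_density f z) \<partial>lborel)"
      by (subst nn_integral_circle_averages) auto
    also have "\<dots> = ennreal (C * (LINT z|lborel. fock_density f z))"
      using C(1) by (subst nn_integral_eq_integral[OF intf]) (auto simp: ennreal_mult)
    finally have le: "(\<integral>\<^sup>+z. ennreal (fock_density (T f) z) \<partial>lborel) \<le> ennreal (C * (LINT z|lborel. fock_density f z))" .
    then have int: "integrable lborel (fock_density (T f))"
      by (intro integrableI_nonneg) (auto intro: le_less_trans)
    have "(LINT z|lborel. fock_density (T f) z) \<le> C * (LINT z|lborel. fock_density f z)"
      using le C(1) by (subst (asm) nn_integral_eq_integral[OF int]) (auto intro!: integral_nonneg)
    then have "fock_norm (T f) \<le> sqrt (C * (1 / pi * (LINT z|lborel. fock_density f z)))"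
      unfolding fock_norm_def by (intro real_sqrt_le_mono) (simp add: field_simps)
    then have "fock_norm (T f) \<le> sqrt C * fock_norm f"
      by (simp only: fock_norm_def real_sqrt_mult)
    then show "T f \<in> fock \<and> fock_norm (T f) \<le> sqrt C * fock_norm f"
      using int holT by (simp add: fock_def)
  qed
qed

section \<open>The isomorphism, dimensions and insertion indices\<close>

lemma vanishing_space_eq: "vanishing_space \<Lambda> = {f \<in> fock. vanishes f}"
  by (auto simp: vanishing_space_def vanishes_def fock_def)

lemma T_maps: "f \<in> vanishing_space \<Lambda> \<Longrightarrow> T f \<in> vanishing_space \<Lambda>'"
  using T_bounded T_vanishes
  unfolding vanishing_space_eq cluster_pair.vanishing_space_eq[OF swap] by blast

lemma T_swap_T_space:
  "f \<in> vanishing_space \<Lambda> \<Longrightarrow> mult_operator (cluster_product I \<Gamma>' \<Gamma>) (T f) = f"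
  by (rule T_swap_T) (simp add: vanishing_space_eq)

lemmas T_swap_maps = cluster_pair.T_maps[OF swap]
  and T_T_swap_space = cluster_pair.T_swap_T_space[OF swap]

lemma T_iso: "bounded_linear_iso (vanishing_space \<Lambda>) (vanishing_space \<Lambda>') T"
  unfolding bounded_linear_iso_def
proof (intro conjI)
  show "bij_betw T (vanishing_space \<Lambda>) (vanishing_space \<Lambda>')"
    by (rule bij_betw_byWitness[where f' = "mult_operator (cluster_product I \<Gamma>' \<Gamma>)"])
      (auto simp: T_swap_T_space T_T_swap_space intro: T_maps T_swap_maps)
  show "\<forall>f\<in>vanishing_space \<Lambda>. \<forall>g\<in>vanishing_space \<Lambda>. T (\<lambda>z. f z + g z) = (\<lambda>z. T f z + T g z)"
    by (simp add: vanishing_space_eq T_add)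
  show "\<forall>a. \<forall>f\<in>vanishing_space \<Lambda>. T (\<lambda>z. a * f z) = (\<lambda>z. a * T f z)"
    by (simp add: vanishing_space_eq T_scale)
  obtain C where "\<And>f. f \<in> fock \<Longrightarrow> vanishes f \<Longrightarrow> T f \<in> fock \<and> fock_norm (T f) \<le> C * fock_norm f"
    using T_bounded by blast
  then show "\<exists>C. \<forall>f\<in>vanishing_space \<Lambda>. fock_norm (T f) \<le> C * fock_norm f"
    by (auto simp: vanishing_space_eq)
  obtain C' where C': "\<And>f. f \<in> fock \<Longrightarrow> cluster_pair.vanishes I \<Gamma>' f \<Longrightarrow>
      mult_operator (cluster_product I \<Gamma>' \<Gamma>) f \<in> fock \<and>
      fock_norm (mult_operator (cluster_product I \<Gamma>' \<Gamma>) f) \<le> C' * fock_norm f"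
    using cluster_pair.T_bounded[OF swap] by blast
  have "fock_norm f \<le> C' * fock_norm (T f)" if "f \<in> vanishing_space \<Lambda>" for f
    using C'[of "T f"] T_maps[OF that] T_swap_T_space[OF that]
    by (simp add: cluster_pair.vanishing_space_eq[OF swap])
  then show "\<exists>C. \<forall>f\<in>vanishing_space \<Lambda>. fock_norm f \<le> C * fock_norm (T f)" by blast
qed

lemma T_fun_scale_sum:
  assumes "finite A" "A \<subseteq> vanishing_space \<Lambda>" "v = (\<Sum>b\<in>A. fun_scale (a b) b)"
  shows "T v = (\<Sum>b\<in>A. fun_scale (a b) (T b))"
proof -
  have sum_apply: "(\<Sum>b\<in>A. F b) z = (\<Sum>b\<in>A. F b z)" for F :: "(complex \<Rightarrow> complex) \<Rightarrow> complex \<Rightarrow> complex" and z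
    by (induction A rule: infinite_finite_induct) auto
  have "T v = (\<lambda>z. \<Sum>b\<in>A. a b * T b z)"
    using assms by (intro T_linear_combination) (auto simp: vanishing_space_eq sum_apply fun_scale_def)
  then show ?thesis by (simp add: fun_eq_iff sum_apply fun_scale_def)
qed

lemma zero_in_vanishing_space: "0 \<in> vanishing_space L"
  by (simp add: vanishing_space_def fock_def zero_fun_def)

lemma cdim_eq: "(cdim (vanishing_space \<Lambda>), cdim (vanishing_space \<Lambda>')) \<in> ordIso"
  by (rule cdim_ordIsoI[where T = T and T' = "mult_operator (cluster_product I \<Gamma>' \<Gamma>)"])
    (auto simp: T_maps T_swap_maps T_swap_T_space T_T_swap_space zero_in_vanishing_space
       intro: T_fun_scale_sum cluster_pair.T_fun_scale_sum[OF swap])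

text \<open>
  If \<open>f\<close> has the zeros \<open>\<Lambda> + \<nu>\<close>, then \<open>T f\<close> has the zeros \<open>\<Lambda>' + \<nu>\<close>. The inserted multiset \<open>\<nu>\<close> is the same
  on both sides, so the two index sets in the definition of the insertion index coincide.
\<close>
lemma exact_zero_multiset_transfer:
  assumes "exact_zero_multiset (\<lambda>z. \<Lambda> z + count \<nu> z)"
  shows "exact_zero_multiset (\<lambda>z. \<Lambda>' z + count \<nu> z)"
proof -
  obtain f w0 where f: "f \<in> fock" "f w0 \<noteq> 0" "zero_multiset f = (\<lambda>z. \<Lambda> z + count \<nu> z)"
    using assms by (auto simp: exact_zero_multiset_def)
  then have van: "vanishes f" by (simp add: vanishes_def fock_def)
  have "T f \<in> fock" using T_maps[of f] f(1) van
    by (simp add: vanishing_space_eq cluster_pair.vanishing_space_eq[OF swap])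
  then show ?thesis
    using zero_multiset_T[OF van f(2)] unfolding exact_zero_multiset_def
    by (intro bexI[of _ "T f"]) (auto simp: f(3))
qed

lemma insertion_index_eq: "insertion_index \<Lambda> = insertion_index \<Lambda>'"
  using exact_zero_multiset_transfer cluster_pair.exact_zero_multiset_transfer[OF swap]
  unfolding insertion_index_def by metis

end

text \<open>
  Only finitely many centres lie in a bounded region because each of the corresponding clusters contains a
  point of the locally finite multiset, and each point belongs to finitely many clusters. The bound
  on the radii is replaced by its maximum with \<open>0\<close>, as \<open>H\<close> may be negative when \<open>I\<close> is empty.
\<close>
lemma cluster_pairI:
  fixes L :: "complex \<Rightarrow> nat" and I :: "'i set" and c :: "'i \<Rightarrow> complex" and r :: "'i \<Rightarrow> real"
  assumes lf: "locally_finite L" and part: "partitioned_into L I \<Gamma>"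
    and r: "\<And>\<alpha>. \<alpha> \<in> I \<Longrightarrow> 0 \<le> r \<alpha> \<and> r \<alpha> \<le> H"
    and disc: "\<And>\<alpha>. \<alpha> \<in> I \<Longrightarrow> set_mset (\<Gamma> \<alpha>) \<union> set_mset (\<Gamma>' \<alpha>) \<subseteq> {z. cmod (z - c \<alpha>) \<le> r \<alpha>}"
    and size: "\<And>\<alpha>. \<alpha> \<in> I \<Longrightarrow> size (\<Gamma> \<alpha>) = size (\<Gamma>' \<alpha>)"
    and sums: "\<And>\<alpha> p. \<alpha> \<in> I \<Longrightarrow> p \<in> {1, 2::nat} \<Longrightarrow> (\<Sum>\<xi>\<in>#\<Gamma> \<alpha>. \<xi> ^ p) = (\<Sum>\<mu>\<in>#\<Gamma>' \<alpha>. \<mu> ^ p)"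
    and mass: "(SUP w::complex. \<Sum>\<^sub>\<infinity>\<alpha> \<in> {\<alpha> \<in> I. cmod (c \<alpha> - w) < 1}.
            ennreal (real (size (\<Gamma> \<alpha>)) * r \<alpha> ^ 3)) < \<infinity>" (is "?S < \<infinity>")
  shows "cluster_pair I \<Gamma> \<Gamma>' c r (max H 0) (enn2real ?S)"
proof
  fix R :: real
  define Z where "Z = {z \<in> cball 0 (R + H). L z \<noteq> 0}"
  have "finite Z" using lf unfolding locally_finite_def Z_def by (meson compact_cball)
  then have "finite (\<Union>z\<in>Z. {\<alpha>\<in>I. z \<in># \<Gamma> \<alpha>})"
    using part by (intro finite_UN_I) (auto simp: partitioned_into_def)
  moreover have "{\<alpha>\<in>I. cmod (c \<alpha>) \<le> R} \<subseteq> (\<Union>z\<in>Z. {\<alpha>\<in>I. z \<in># \<Gamma> \<alpha>})"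
  proof
    fix \<alpha> assume \<alpha>: "\<alpha> \<in> {\<alpha>\<in>I. cmod (c \<alpha>) \<le> R}"
    then have "\<Gamma> \<alpha> \<noteq> {#}" using part by (auto simp: partitioned_into_def)
    then obtain z where z: "z \<in># \<Gamma> \<alpha>" by (rule multiset_nonemptyE)
    have "cmod (z - c \<alpha>) \<le> H" using disc[of \<alpha>] r[of \<alpha>] \<alpha> z by fastforce
    then have "cmod z \<le> R + H" using norm_triangle_ineq2[of z "c \<alpha>"] \<alpha> by auto
    moreover have "L z \<noteq> 0"
      using part \<alpha> z by (auto simp: partitioned_into_def sum_eq_0_iff)
    ultimately show "\<alpha> \<in> (\<Union>z\<in>Z. {\<alpha>\<in>I. z \<in># \<Gamma> \<alpha>})" using \<alpha> z by (auto simp: Z_def)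
  qed
  ultimately show "finite {\<alpha>\<in>I. cmod (c \<alpha>) \<le> R}" by (rule finite_subset[rotated])
next
  fix F w assume F: "finite F" "F \<subseteq> {\<alpha> \<in> I. cmod (c \<alpha> - w) < 1}"
  let ?m = "\<lambda>\<alpha>. real (size (\<Gamma> \<alpha>)) * r \<alpha> ^ 3"
  have "ennreal (sum ?m F) = (\<Sum>\<alpha>\<in>F. ennreal (?m \<alpha>))"
    using F r by (intro sum_ennreal[symmetric]) auto
  also have "\<dots> \<le> (\<Sum>\<^sub>\<infinity>\<alpha> \<in> {\<alpha> \<in> I. cmod (c \<alpha> - w) < 1}. ennreal (?m \<alpha>))"
    using F by (subst nonneg_infsum_complete) (auto intro: SUP_upper)
  also have "\<dots> \<le> ?S" by (rule SUP_upper) simp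
  finally have "ennreal (sum ?m F) \<le> ennreal (enn2real ?S)" using mass by simp
  then show "sum ?m F \<le> enn2real ?S" by simp
next
  fix \<alpha> assume \<alpha>: "\<alpha> \<in> I"
  show "\<Sum>\<^sub># (\<Gamma> \<alpha>) = \<Sum>\<^sub># (\<Gamma>' \<alpha>)" using sums[OF \<alpha>, of 1] by simp
  show "(\<Sum>\<xi>\<in>#\<Gamma> \<alpha>. \<xi>\<^sup>2) = (\<Sum>\<xi>\<in>#\<Gamma>' \<alpha>. \<xi>\<^sup>2)" using sums[OF \<alpha>, of 2] by simp
  show "r \<alpha> \<le> max H 0" using r[OF \<alpha>] by simp
  fix \<xi>
  show "cmod (\<xi> - c \<alpha>) \<le> r \<alpha>" if "\<xi> \<in># \<Gamma> \<alpha>" using disc[OF \<alpha>] that by auto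
  show "cmod (\<xi> - c \<alpha>) \<le> r \<alpha>" if "\<xi> \<in># \<Gamma>' \<alpha>" using disc[OF \<alpha>] that by auto
qed (use r size in auto)

theorem corollary7p6:
  fixes \<Lambda> \<Lambda>' :: "complex \<Rightarrow> nat"
    and I :: "'i set"
    and \<Gamma> \<Gamma>' :: "'i \<Rightarrow> complex multiset"
    and c :: "'i \<Rightarrow> complex"
    and r :: "'i \<Rightarrow> real"
    and H :: real
    and Q :: "complex \<Rightarrow> complex"
  assumes "locally_finite \<Lambda>"
    and "partitioned_into \<Lambda> I \<Gamma>"
    and "\<And>\<alpha>. \<alpha> \<in> I \<Longrightarrow> 0 \<le> r \<alpha> \<and> r \<alpha> \<le> H"
    and "\<And>\<alpha>. \<alpha> \<in> I \<Longrightarrow> set_mset (\<Gamma> \<alpha>) \<union> set_mset (\<Gamma>' \<alpha>) \<subseteq> {z. cmod (z - c \<alpha>) \<le> r \<alpha>}"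
    and "\<And>\<alpha>. \<alpha> \<in> I \<Longrightarrow> size (\<Gamma> \<alpha>) = size (\<Gamma>' \<alpha>)"
    and "\<And>\<alpha> p. \<alpha> \<in> I \<Longrightarrow> p \<in> {1, 2::nat} \<Longrightarrow> (\<Sum>\<xi>\<in>#\<Gamma> \<alpha>. \<xi> ^ p) = (\<Sum>\<mu>\<in>#\<Gamma>' \<alpha>. \<mu> ^ p)"
    and "(SUP w::complex. \<Sum>\<^sub>\<infinity>\<alpha> \<in> {\<alpha> \<in> I. cmod (c \<alpha> - w) < 1}.
            ennreal (real (size (\<Gamma> \<alpha>)) * r \<alpha> ^ 3)) < \<infinity>"
  defines "\<Lambda>' \<equiv> multiset_sum I \<Gamma>'"
    and "Q \<equiv> cluster_product I \<Gamma> \<Gamma>'"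
  shows
    (* the product defining Q converges, to a meromorphic function with divisor \<Lambda>' - \<Lambda> *)
    "(\<forall>K. compact K \<longrightarrow> (\<forall>z\<in>K. \<Lambda> z = 0) \<longrightarrow>
        uniform_limit K (\<lambda>F z. \<Prod>\<alpha>\<in>F. cluster_factor (\<Gamma> \<alpha>) (\<Gamma>' \<alpha>) z) Q (finite_subsets_at_top I)) \<and>
     Q nicely_meromorphic_on UNIV \<and>
     (\<forall>z. zorder Q z = int (\<Lambda>' z) - int (\<Lambda> z)) \<and>
     bounded_linear_iso (vanishing_space \<Lambda>) (vanishing_space \<Lambda>') (mult_operator Q) \<and>
     (cdim (vanishing_space \<Lambda>), cdim (vanishing_space \<Lambda>')) \<in> ordIso \<and>
     (exact_zero_multiset \<Lambda> \<longrightarrow> exact_zero_multiset \<Lambda>' \<longrightarrow>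
        insertion_index \<Lambda> = insertion_index \<Lambda>')"
proof -
  interpret cluster_pair I \<Gamma> \<Gamma>' c r "max H 0" "enn2real (SUP w::complex.
      \<Sum>\<^sub>\<infinity>\<alpha> \<in> {\<alpha> \<in> I. cmod (c \<alpha> - w) < 1}. ennreal (real (size (\<Gamma> \<alpha>)) * r \<alpha> ^ 3))"
    using assms(1-7) by (rule cluster_pairI)
  have \<Lambda>: "\<Lambda> = multiset_sum I \<Gamma>"
    using assms(2) by (auto simp: partitioned_into_def multiset_sum_def fun_eq_iff)
  show ?thesis
    unfolding \<Lambda> \<Lambda>'_def Q_def
    using uniform_limit_Q Q_nicely_meromorphic zorder_Q T_iso cdim_eq insertion_index_eq by blast
qed

end
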